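(* Let $A$ be a graded superring, $B$ a graded subring, $\alpha$ an automorphism of $A$, $\beta$ an automorphism of $B$, and fix $\lambda\in\Lambda$ and $\pi\in\mathbb{Z}_2$. The set of conditions (L1) $A$ is finitely generated and projective as a left $B$-module, (L2) ${}_AA_B\cong\mathrm{HOM}^{\mathrm L}_B\big({}^{\beta}_{B}A^{\alpha}_{A},\{\lambda,\pi\}{}_BB_B\big)$ as $(A,B)$-bimodules, is equivalent to the set of conditions (R1) $A$ is finitely generated and projective as a right $B$-module, (R2) ${}_BA_A\cong\mathrm{HOM}^{\mathrm R}_B\big({}^{\alpha^{-1}}_{A}A^{\beta^{-1}}_{B},\{\lambda,\pi\}{}_BB_B\big)$ as $(B,A)$-bimodules.
   Context: Fix an abelian group $\Lambda$. A graded superring is an associative unital $\Lambda\times\mathbb{Z}_2$-graded ring; subrings are graded (with the same unit), automorphisms preserve the grading, and modules and bimodules are $\Lambda\times\mathbb{Z}_2$-graded. For homogeneous $v$, $|v|\in\Lambda$ and $\bar v\in\mathbb{Z}_2$ denote its degrees; formulas involving degrees are stated for homogeneous elements and extended additively. Homomorphisms of modules and bimodules are additive maps of degree $(0,0)$ commuting strictly with the actions. Shifts: $\{\mu,\gamma\}M$ is $M$ as an abelian group, with $(\{\mu,\gamma\}M)_{\nu,\delta}=M_{\nu-\mu,\delta+\gamma}$, unchanged right action, and left action $a\cdot\{\mu,\gamma\}m=(-1)^{\gamma\bar a}\{\mu,\gamma\}(am)$. Twists: ${}^{\beta}_{B}A^{\alpha}_{A}$ is $A$ as a graded abelian group with $b\cdot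 x=\beta(b)x$ ($b\in B$) and $x\cdot a=x\alpha(a)$ ($a\in A$); ${}^{\alpha^{-1}}_{A}A^{\beta^{-1}}_{B}$ is $A$ with $a\cdot x=\alpha^{-1}(a)x$ and $x\cdot b=x\beta^{-1}(b)$. ${}_AA_B$, ${}_BA_A$, ${}_BB_B$ carry the multiplication actions. $\mathrm{HOM}^{\mathrm L}_B({}^{\beta}_{B}A^{\alpha}_{A},\{\lambda,\pi\}{}_BB_B)$ is the direct sum over $(\mu,\gamma)\in\Lambda\times\mathbb{Z}_2$ of the groups of additive maps $f\colon A\to\{\lambda,\pi\}B$ of degree $(\mu,\gamma)$ with $f(\beta(b)x)=(-1)^{\gamma\bar b}\,b\cdot f(x)$ (action in $\{\lambda,\pi\}B$). It is an $(A,B)$-bimodule via $(a\cdot f)(x)=(-1)^{\bar a\bar f+\bar a\bar x}f(x\alpha(a))$ and $(f\cdot b)(x)=(-1)^{\bar b\bar x}f(x)b$. $\mathrm{HOM}^{\mathrm R}_B({}^{\alpha^{-1}}_{A}A^{\beta^{-1}}_{B},\{\lambda,\pi\}{}_BB_B)$ is the direct sum over $(\mu,\gamma)$ of the groups of additive maps $f\colon A\to\{\lambda,\pi\}B$ of degree $(\mu,\gamma)$ with $f(x\beta^{-1}(b))=f(x)b$. It is a $(B,A)$-bimodule via $(b\cdot f)(x)=b\cdot f(x)$ (left action in $\{\lambda,\pi\}B$) and $(f\cdot a)(x)=f(\alpha^{-1}(a)x)$. *)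

theory Defs
  imports "HOL-Library.Z2" "HOL-Library.Product_Plus" "HOL-Library.Function_Algebras"
begin

section \<open>Graded abelian groups\<close>

text \<open>
  Degrees are pairs in Lambda x Z/2, where Lambda is the additive group given by the type
  \<open>'l\<close>.  Graded groups are subsets of a type of class \<open>ab_group_add\<close>; for sets of maps this type
  is a function type with pointwise addition.
\<close>

type_synonym 'l deg = "'l \<times> bit"

definition add_subgroup :: "'m::ab_group_add set \<Rightarrow> bool" where
  "add_subgroup X \<longleftrightarrow> 0 \<in> X \<and> (\<forall>x\<in>X. \<forall>y\<in>X. x - y \<in> X)"

definition additive_on :: "'m::ab_group_add set \<Rightarrow> ('m \<Rightarrow> 'n::ab_group_add) \<Rightarrow> bool" where
  "additive_on X f \<longleftrightarrow> (\<forall>x\<in>X. \<forall>y\<in>X. f (x + y) = f x + f y)"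

definition decomposes :: "('l deg \<Rightarrow> 'm::ab_group_add set) \<Rightarrow> 'm \<Rightarrow> ('l deg \<Rightarrow> 'm) \<Rightarrow> bool" where
  "decomposes G x c \<longleftrightarrow> finite {d. c d \<noteq> 0} \<and> (\<forall>d. c d \<in> G d) \<and> x = (\<Sum>d | c d \<noteq> 0. c d)"

definition graded_by :: "'m::ab_group_add set \<Rightarrow> ('l deg \<Rightarrow> 'm set) \<Rightarrow> bool" where
  "graded_by X G \<longleftrightarrow> add_subgroup X \<and> (\<forall>d. add_subgroup (G d) \<and> G d \<subseteq> X)
     \<and> (\<forall>x\<in>X. \<exists>!c. decomposes G x c)"

definition hcomp :: "('l deg \<Rightarrow> 'm::ab_group_add set) \<Rightarrow> 'm \<Rightarrow> 'l deg \<Rightarrow> 'm" where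
  "hcomp G x = (THE c. decomposes G x c)"

text \<open>
  Additive extension of a formula \<open>F d x\<close> that is given for elements \<open>x\<close> homogeneous of degree
  \<open>d\<close>: it is summed over the nonzero homogeneous components.
\<close>

definition hext ::
    "('l deg \<Rightarrow> 'm::ab_group_add set) \<Rightarrow> ('l deg \<Rightarrow> 'm \<Rightarrow> 'n::ab_group_add) \<Rightarrow> 'm \<Rightarrow> 'n" where
  "hext G F x = (\<Sum>d | hcomp G x d \<noteq> 0. F d (hcomp G x d))"

text \<open>\<open>signed \<gamma> x\<close> is \<open>(-1)\<close> to the power \<open>\<gamma>\<close>, times \<open>x\<close>.\<close>

definition signed :: "bit \<Rightarrow> 'm::ab_group_add \<Rightarrow> 'm" where
  "signed \<gamma> x = (if \<gamma> = 0 then x else - x)"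

section \<open>Graded superrings\<close>

text \<open>
  The sort \<open>{ring, monoid_mult}\<close> is that of associative unital rings; unlike \<open>ring_1\<close> it
  admits the zero ring.  Closure of \<open>X\<close> under multiplication follows from the last condition.
\<close>

definition graded_superring ::
    "'a::{ring,monoid_mult} set \<Rightarrow> ('l::ab_group_add deg \<Rightarrow> 'a set) \<Rightarrow> bool" where
  "graded_superring X G \<longleftrightarrow> 1 \<in> X \<and> graded_by X G
     \<and> (\<forall>d e. \<forall>x\<in>G d. \<forall>y\<in>G e. x * y \<in> G (d + e))"

definition sub_grading :: "('l deg \<Rightarrow> 'a set) \<Rightarrow> 'a set \<Rightarrow> 'l deg \<Rightarrow> 'a set" where
  "sub_grading G B d = B \<inter> G d"

definition graded_subring ::
    "('l::ab_group_add deg \<Rightarrow> 'a::{ring,monoid_mult} set) \<Rightarrow> 'a set \<Rightarrow> bool" where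
  "graded_subring G B \<longleftrightarrow> graded_superring B (sub_grading G B)"

definition graded_automorphism ::
    "'a::{ring,monoid_mult} set \<Rightarrow> ('l deg \<Rightarrow> 'a set) \<Rightarrow> ('a \<Rightarrow> 'a) \<Rightarrow> bool" where
  "graded_automorphism X G \<alpha> \<longleftrightarrow> bij_betw \<alpha> X X \<and> additive_on X \<alpha>
     \<and> (\<forall>x\<in>X. \<forall>y\<in>X. \<alpha> (x * y) = \<alpha> x * \<alpha> y) \<and> \<alpha> 1 = 1 \<and> (\<forall>d. \<alpha> ` G d \<subseteq> G d)"

section \<open>Bimodules\<close>

text \<open>
  The acting rings are not part of the record: \<open>lact\<close> and \<open>ract\<close> are meant on their carriers only,
  and these are arguments of the predicates below.
\<close>

record ('l, 'r, 's, 'm) bimodule =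
  carrier :: "'m set"
  grade :: "'l deg \<Rightarrow> 'm set"
  lact :: "'r \<Rightarrow> 'm \<Rightarrow> 'm"
  ract :: "'m \<Rightarrow> 's \<Rightarrow> 'm"

definition mult_bimodule ::
    "'a::{ring,monoid_mult} set \<Rightarrow> ('l deg \<Rightarrow> 'a set) \<Rightarrow> ('l, 'a, 'a, 'a) bimodule" where
  "mult_bimodule X G = \<lparr>carrier = X, grade = G, lact = (\<lambda>a x. a * x), ract = (\<lambda>x a. x * a)\<rparr>"

text \<open>\<open>twisted_bimodule X G \<rho> \<sigma>\<close> has the left action twisted by \<open>\<rho>\<close> and the right one by \<open>\<sigma>\<close>.\<close>

definition twisted_bimodule ::
    "'a::{ring,monoid_mult} set \<Rightarrow> ('l deg \<Rightarrow> 'a set) \<Rightarrow> ('a \<Rightarrow> 'a) \<Rightarrow> ('a \<Rightarrow> 'a)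
      \<Rightarrow> ('l, 'a, 'a, 'a) bimodule" where
  "twisted_bimodule X G \<rho> \<sigma> =
     \<lparr>carrier = X, grade = G, lact = (\<lambda>b x. \<rho> b * x), ract = (\<lambda>x a. x * \<sigma> a)\<rparr>"

text \<open>\<open>GR\<close> is the grading of the ring acting from the left.\<close>

definition shift ::
    "('l::ab_group_add deg \<Rightarrow> 'r::ab_group_add set) \<Rightarrow> 'l deg
      \<Rightarrow> ('l, 'r, 's, 'm::ab_group_add) bimodule \<Rightarrow> ('l, 'r, 's, 'm) bimodule" where
  "shift GR s M = (case s of (\<mu>, \<gamma>) \<Rightarrow>
     \<lparr>carrier = carrier M,
      grade = (\<lambda>(\<nu>, \<delta>). grade M (\<nu> - \<mu>, \<delta> + \<gamma>)),
      lact = (\<lambda>a m. hext GR (\<lambda>p a'. signed (\<gamma> * snd p) (lact M a' m)) a),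
      ract = ract M\<rparr>)"

definition graded_hom ::
    "('l, 'r, 's, 'm::ab_group_add) bimodule \<Rightarrow> ('l, 'r, 's, 'n::ab_group_add) bimodule
      \<Rightarrow> ('m \<Rightarrow> 'n) \<Rightarrow> bool" where
  "graded_hom M N f \<longleftrightarrow> f ` carrier M \<subseteq> carrier N \<and> additive_on (carrier M) f
     \<and> (\<forall>d. f ` grade M d \<subseteq> grade N d)"

definition left_hom ::
    "'r set \<Rightarrow> ('l, 'r, 's, 'm::ab_group_add) bimodule \<Rightarrow> ('l, 'r, 's, 'n::ab_group_add) bimodule
      \<Rightarrow> ('m \<Rightarrow> 'n) \<Rightarrow> bool" where
  "left_hom R M N f \<longleftrightarrow> graded_hom M N f
     \<and> (\<forall>r\<in>R. \<forall>x\<in>carrier M. f (lact M r x) = lact N r (f x))"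

definition right_hom ::
    "'s set \<Rightarrow> ('l, 'r, 's, 'm::ab_group_add) bimodule \<Rightarrow> ('l, 'r, 's, 'n::ab_group_add) bimodule
      \<Rightarrow> ('m \<Rightarrow> 'n) \<Rightarrow> bool" where
  "right_hom S M N f \<longleftrightarrow> graded_hom M N f
     \<and> (\<forall>s\<in>S. \<forall>x\<in>carrier M. f (ract M x s) = ract N (f x) s)"

definition bimodule_iso ::
    "'r set \<Rightarrow> 's set \<Rightarrow> ('l, 'r, 's, 'm::ab_group_add) bimodule
      \<Rightarrow> ('l, 'r, 's, 'n::ab_group_add) bimodule \<Rightarrow> bool" where
  "bimodule_iso R S M N \<longleftrightarrow>
     (\<exists>f. left_hom R M N f \<and> right_hom S M N f \<and> bij_betw f (carrier M) (carrier N))"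

section \<open>Finitely generated and projective modules\<close>

text \<open>
  The direct sum of the shifts of \<open>B\<close> by \<open>s i\<close>, \<open>i \<in> I\<close>: finitely supported families, extended by
  0 outside \<open>I\<close>.  With its left (right) action this is the graded free left (right) \<open>B\<close>-module on
  generators of degree \<open>s i\<close>.
\<close>

definition free_bimodule ::
    "'b::{ring,monoid_mult} set \<Rightarrow> ('l::ab_group_add deg \<Rightarrow> 'b set) \<Rightarrow> 'i set \<Rightarrow> ('i \<Rightarrow> 'l deg)
      \<Rightarrow> ('l, 'b, 'b, 'i \<Rightarrow> 'b) bimodule" where
  "free_bimodule B G I s =
     (let F = {v. finite {i. v i \<noteq> 0} \<and> (\<forall>i\<in>I. v i \<in> B) \<and> (\<forall>i. i \<notin> I \<longrightarrow> v i = 0)};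
          N = (\<lambda>i. shift G (s i) (mult_bimodule B G))
      in \<lparr>carrier = F,
          grade = (\<lambda>d. {v \<in> F. \<forall>i\<in>I. v i \<in> grade (N i) d}),
          lact = (\<lambda>b v i. lact (N i) b (v i)),
          ract = (\<lambda>v b i. ract (N i) (v i) b)\<rparr>)"

definition fin_gen_left ::
    "'b set \<Rightarrow> ('l, 'b, 's, 'm::ab_group_add) bimodule \<Rightarrow> bool" where
  "fin_gen_left B M \<longleftrightarrow> (\<exists>X. finite X \<and> X \<subseteq> carrier M
     \<and> (\<forall>m\<in>carrier M. \<exists>c. c ` X \<subseteq> B \<and> m = (\<Sum>x\<in>X. lact M (c x) x)))"

definition fin_gen_right ::
    "'b set \<Rightarrow> ('l, 'r, 'b, 'm::ab_group_add) bimodule \<Rightarrow> bool" where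
  "fin_gen_right B M \<longleftrightarrow> (\<exists>X. finite X \<and> X \<subseteq> carrier M
     \<and> (\<forall>m\<in>carrier M. \<exists>c. c ` X \<subseteq> B \<and> m = (\<Sum>x\<in>X. ract M x (c x))))"

text \<open>
  Projective means: direct summand of a graded free module, with respect to homomorphisms of
  degree 0.  Taking the index set inside the type \<open>'m\<close> of the module is no restriction: the nonzero
  homogeneous elements generate, and a graded projective module is a direct summand of the free
  module on any family of homogeneous generators.
\<close>

definition projective_left ::
    "'b::{ring,monoid_mult} set \<Rightarrow> ('l::ab_group_add deg \<Rightarrow> 'b set)
      \<Rightarrow> ('l, 'b, 'b, 'm::ab_group_add) bimodule \<Rightarrow> bool" where
  "projective_left B G M \<longleftrightarrow> (\<exists>(I :: 'm set) s j p.
     left_hom B M (free_bimodule B G I s) j \<and> left_hom B (free_bimodule B G I s) M p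
     \<and> (\<forall>x\<in>carrier M. p (j x) = x))"

definition projective_right ::
    "'b::{ring,monoid_mult} set \<Rightarrow> ('l::ab_group_add deg \<Rightarrow> 'b set)
      \<Rightarrow> ('l, 'b, 'b, 'm::ab_group_add) bimodule \<Rightarrow> bool" where
  "projective_right B G M \<longleftrightarrow> (\<exists>(I :: 'm set) s j p.
     right_hom B M (free_bimodule B G I s) j \<and> right_hom B (free_bimodule B G I s) M p
     \<and> (\<forall>x\<in>carrier M. p (j x) = x))"

section \<open>HOM bimodules\<close>

text \<open>
  Below \<open>M\<close> is always a module whose carrier is its whole type \<open>'m\<close>, so its maps are plain functions
  \<open>'m \<Rightarrow> 'n\<close>.  The direct sum over all degrees of the groups of maps of a given degree is
  the internal one, formed in the group of all functions; the sum is direct because nonzero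
  maps of distinct degrees between graded groups are independent.
\<close>

definition internal_sum :: "('l deg \<Rightarrow> 'm::ab_group_add set) \<Rightarrow> 'm set" where
  "internal_sum H = {x. \<exists>c. decomposes H x c}"

definition maps_of_degree ::
    "('l::ab_group_add, 'r, 's, 'm::ab_group_add) bimodule
      \<Rightarrow> ('l, 't, 'u, 'n::ab_group_add) bimodule \<Rightarrow> 'l deg \<Rightarrow> ('m \<Rightarrow> 'n) set" where
  "maps_of_degree M N e = {f. additive_on UNIV f \<and> (\<forall>d. f ` grade M d \<subseteq> grade N (d + e))}"

definition left_maps ::
    "('l::ab_group_add deg \<Rightarrow> 'b set) \<Rightarrow> ('l, 'b, 'a, 'm::ab_group_add) bimodule
      \<Rightarrow> ('l, 'b, 's, 'n::ab_group_add) bimodule \<Rightarrow> 'l deg \<Rightarrow> ('m \<Rightarrow> 'n) set" where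
  "left_maps GB M N e = {f \<in> maps_of_degree M N e.
     \<forall>d. \<forall>b\<in>GB d. \<forall>x. f (lact M b x) = signed (snd e * snd d) (lact N b (f x))}"

definition right_maps ::
    "'b set \<Rightarrow> ('l::ab_group_add, 'a, 'b, 'm::ab_group_add) bimodule
      \<Rightarrow> ('l, 'r, 'b, 'n::ab_group_add) bimodule \<Rightarrow> 'l deg \<Rightarrow> ('m \<Rightarrow> 'n) set" where
  "right_maps B M N e = {f \<in> maps_of_degree M N e.
     \<forall>b\<in>B. \<forall>x. f (ract M x b) = ract N (f x) b}"

text \<open>
  For a \<open>(B,A)\<close>-bimodule \<open>M\<close> and a \<open>(B,B)\<close>-bimodule \<open>N\<close>; \<open>GA\<close> and \<open>GB\<close> are the gradings of
  \<open>A\<close> and \<open>B\<close>.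
\<close>

definition HOM_left ::
    "('l::ab_group_add deg \<Rightarrow> 'a::ab_group_add set) \<Rightarrow> ('l deg \<Rightarrow> 'b::ab_group_add set)
      \<Rightarrow> ('l, 'b, 'a, 'm::ab_group_add) bimodule \<Rightarrow> ('l, 'b, 'b, 'n::ab_group_add) bimodule
      \<Rightarrow> ('l, 'a, 'b, 'm \<Rightarrow> 'n) bimodule" where
  "HOM_left GA GB M N =
     \<lparr>carrier = internal_sum (left_maps GB M N),
      grade = left_maps GB M N,
      lact = (\<lambda>a f x.
        hext GA (\<lambda>p a'. hext (left_maps GB M N) (\<lambda>q f'. hext (grade M) (\<lambda>r x'.
          signed (snd p * snd q + snd p * snd r) (f' (ract M x' a'))) x) f) a),
      ract = (\<lambda>f b x.
        hext GB (\<lambda>p b'. hext (grade M) (\<lambda>r x'.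
          signed (snd p * snd r) (ract N (f x') b')) x) b)\<rparr>"

text \<open>For an \<open>(A,B)\<close>-bimodule \<open>M\<close> and a \<open>(B,B)\<close>-bimodule \<open>N\<close>.\<close>

definition HOM_right ::
    "'b set \<Rightarrow> ('l::ab_group_add, 'a, 'b, 'm::ab_group_add) bimodule
      \<Rightarrow> ('l, 'b, 'b, 'n::ab_group_add) bimodule \<Rightarrow> ('l, 'b, 'a, 'm \<Rightarrow> 'n) bimodule" where
  "HOM_right B M N =
     \<lparr>carrier = internal_sum (right_maps B M N),
      grade = right_maps B M N,
      lact = (\<lambda>b f x. lact N b (f x)),
      ract = (\<lambda>f a x. f (lact M a x))\<rparr>"

end

theory Submission
  imports Defs
begin

text \<open>
  Write \<open>sg \<gamma>\<close> for the automorphism \<open>x \<mapsto> (-1)\<close> to the power \<open>\<gamma>\<close> times the parity of \<open>x\<close>, which absorbs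
  all signs, and \<open>\<theta> = \<beta> \<circ> sg \<pi>\<close>.  Both sides are equivalent to the existence of a symmetric datum: a
  map \<open>\<tau> : A \<rightarrow> B\<close> of degree \<open>-(\<lambda>, \<pi>)\<close> with \<open>\<tau> (\<theta> b * a) = b * \<tau> a\<close> and \<open>\<tau> (a * \<alpha> b) = \<tau> a * b\<close>, and
  finitely many homogeneous \<open>x\<^sub>i\<close>, \<open>y\<^sub>i\<close> with \<open>a = \<Sum> \<theta> (\<tau> (a * y\<^sub>i)) * x\<^sub>i\<close> and
  \<open>a = \<Sum> y\<^sub>i * \<alpha> (\<tau> (x\<^sub>i * a))\<close> for all \<open>a\<close>.

  From a bimodule isomorphism \<open>\<tau>\<close> is recovered as the image of 1, up to passing to \<open>\<beta>\<inverse> \<circ> \<tau> \<circ> \<alpha>\<inverse>\<close>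
  on the right-hand side.  A dual basis of the projective module \<open>A\<close> has coordinate functions that
  the isomorphism represents by elements of \<open>A\<close>; this gives one of the two expansions, and the
  other one follows because the difference of its two sides is in the kernel of the form
  \<open>(a, a') \<mapsto> \<tau> (a * a')\<close>.  Conversely each expansion is a dual basis, and evaluating a homomorphism
  on the opposite expansion shows that it is represented by an element of \<open>A\<close>.
\<close>

section \<open>Graded groups\<close>

text \<open>
  The last four rules turn the arithmetic of Z/2 into bit operations, after which the ring laws
  no longer apply.
\<close>

declare split_paired_All [simp del] split_paired_Ex [simp del]
  add_bit_eq_xor [simp del] mult_bit_eq_and [simp del] minus_bit_def [simp del] uminus_bit_def [simp del]

section \<open>Subgroups, additive maps and sign rules\<close>

lemma sum_fun_apply: "(\<Sum>i\<in>I. f i) x = (\<Sum>i\<in>I. f i x)" for f :: "'i \<Rightarrow> 'm \<Rightarrow> 'n::ab_group_add"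
  by (induction I rule: infinite_finite_induct) auto

lemma add_subgroup_zero: "add_subgroup X \<Longrightarrow> 0 \<in> X"
  by (simp add: add_subgroup_def)

lemma add_subgroup_diff: "add_subgroup X \<Longrightarrow> x \<in> X \<Longrightarrow> y \<in> X \<Longrightarrow> x - y \<in> X"
  by (simp add: add_subgroup_def)

lemma add_subgroup_uminus: "add_subgroup X \<Longrightarrow> x \<in> X \<Longrightarrow> - x \<in> X"
  using add_subgroup_diff[of X 0 x] add_subgroup_zero by force

lemma add_subgroup_add: "add_subgroup X \<Longrightarrow> x \<in> X \<Longrightarrow> y \<in> X \<Longrightarrow> x + y \<in> X"
  using add_subgroup_diff[of X x "- y"] add_subgroup_uminus by force

lemma add_subgroup_sum:
  "add_subgroup X \<Longrightarrow> (\<And>i. i \<in> I \<Longrightarrow> f i \<in> X) \<Longrightarrow> (\<Sum>i\<in>I. f i) \<in> X"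
  by (induction I rule: infinite_finite_induct) (auto intro: add_subgroup_zero add_subgroup_add)

lemma add_subgroup_UNIV [simp]: "add_subgroup UNIV"
  by (simp add: add_subgroup_def)

lemma additive_on_add: "additive_on X f \<Longrightarrow> x \<in> X \<Longrightarrow> y \<in> X \<Longrightarrow> f (x + y) = f x + f y"
  by (simp add: additive_on_def)

lemma additive_on_zero: "additive_on X f \<Longrightarrow> 0 \<in> X \<Longrightarrow> f 0 = 0"
  using additive_on_add[of X f 0 0] by simp

lemma additive_on_diff:
  assumes "additive_on X f" "add_subgroup X" "x \<in> X" "y \<in> X"
  shows "f (x - y) = f x - f y"
  using additive_on_add[OF assms(1), of "x - y" y] assms add_subgroup_diff[of X x y] by auto

lemma additive_on_uminus:
  assumes "additive_on X f" "add_subgroup X" "x \<in> X"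
  shows "f (- x) = - f x"
  using additive_on_diff[OF assms(1,2), of 0 x] assms
    additive_on_zero[OF assms(1)] add_subgroup_zero[of X] by auto

lemma additive_on_sum:
  assumes "additive_on X f" "add_subgroup X" "\<And>i. i \<in> I \<Longrightarrow> g i \<in> X"
  shows "f (\<Sum>i\<in>I. g i) = (\<Sum>i\<in>I. f (g i))"
  using assms(3)
proof (induction I rule: infinite_finite_induct)
  case (insert i I)
  then have "(\<Sum>i\<in>I. g i) \<in> X"
    by (intro add_subgroup_sum[OF assms(2)]) auto
  with insert show ?case
    using additive_on_add[OF assms(1)] by auto
qed (use additive_on_zero[OF assms(1)] add_subgroup_zero[OF assms(2)] in auto)

lemma signed_0 [simp]: "signed 0 x = x"
  by (simp add: signed_def)

lemma signed_mem: "add_subgroup X \<Longrightarrow> x \<in> X \<Longrightarrow> signed \<gamma> x \<in> X"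
  by (simp add: signed_def add_subgroup_uminus)

lemma signed_plus: "signed \<gamma> (x + y) = signed \<gamma> x + signed \<gamma> y"
  by (simp add: signed_def)

lemma signed_signed: "signed \<gamma> (signed \<delta> x) = signed (\<gamma> + \<delta>) x"
  by (cases \<gamma>; cases \<delta>) (auto simp: signed_def)

lemma signed_twice [simp]: "signed \<gamma> (signed \<gamma> x) = x"
  by (simp add: signed_def)

lemma signed_additive:
  "additive_on X f \<Longrightarrow> add_subgroup X \<Longrightarrow> x \<in> X \<Longrightarrow> f (signed \<gamma> x) = signed \<gamma> (f x)"
  by (simp add: signed_def additive_on_uminus)

lemma signed_mult_left: "signed \<gamma> x * y = signed \<gamma> (x * y)" for x y :: "'a::ring"
  by (simp add: signed_def)

lemma signed_mult_right: "x * signed \<gamma> y = signed \<gamma> (x * y)" for x y :: "'a::ring"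
  by (simp add: signed_def)

section \<open>Homogeneous components and additive extension from homogeneous elements\<close>

locale graded_group =
  fixes X :: "'m::ab_group_add set" and G :: "'l deg \<Rightarrow> 'm set"
  assumes graded: "graded_by X G"
begin

lemma subgroup: "add_subgroup X" and grade_subgroup: "add_subgroup (G d)"
  and grade_subset: "G d \<subseteq> X"
  using graded unfolding graded_by_def by blast+

lemma grade_mem: "x \<in> G d \<Longrightarrow> x \<in> X"
  using grade_subset by blast

lemma decomposes_hcomp:
  assumes "x \<in> X"
  shows "decomposes G x (hcomp G x)"
proof -
  have "\<exists>!c. decomposes G x c"
    using graded assms by (simp add: graded_by_def)
  then show ?thesis
    unfolding hcomp_def by (rule theI')
qed

lemma hcomp_eqI: "x \<in> X \<Longrightarrow> decomposes G x c \<Longrightarrow> hcomp G x = c"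
  using graded decomposes_hcomp by (auto simp: graded_by_def)

lemma hcomp_finite: "x \<in> X \<Longrightarrow> finite {d. hcomp G x d \<noteq> 0}"
  and hcomp_mem: "x \<in> X \<Longrightarrow> hcomp G x d \<in> G d"
  and hcomp_sum: "x \<in> X \<Longrightarrow> (\<Sum>d | hcomp G x d \<noteq> 0. hcomp G x d) = x"
  using decomposes_hcomp[of x] by (simp_all add: decomposes_def)

end

text \<open>Any finite set outside which \<open>c\<close> vanishes may stand in for the exact
  support of \<open>c\<close>.\<close>

lemma decomposesI:
  assumes "finite D" "\<And>d. c d \<in> G d" "\<And>d. d \<notin> D \<Longrightarrow> c d = 0" "x = (\<Sum>d\<in>D. c d)"
  shows "decomposes G x c"
proof -
  have sub: "{d. c d \<noteq> 0} \<subseteq> D"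
    using assms(3) by auto
  then have "(\<Sum>d | c d \<noteq> 0. c d) = (\<Sum>d\<in>D. c d)"
    by (intro sum.mono_neutral_left assms) auto
  with assms sub show ?thesis
    by (auto simp: decomposes_def intro: finite_subset)
qed

lemma decomposes_sum_superset:
  assumes "decomposes G x c" "finite D" "{d. c d \<noteq> 0} \<subseteq> D"
  shows "x = (\<Sum>d\<in>D. c d)"
proof -
  have "(\<Sum>d | c d \<noteq> 0. c d) = (\<Sum>d\<in>D. c d)"
    by (intro sum.mono_neutral_left assms) auto
  then show ?thesis
    using assms by (simp add: decomposes_def)
qed

lemma decomposes_diff:
  assumes "decomposes G x c" "decomposes G y c'" "\<And>d. add_subgroup (G d)"
  shows "decomposes G (x - y) (\<lambda>d. c d - c' d)"
proof -
  let ?D = "{d. c d \<noteq> 0} \<union> {d. c' d \<noteq> 0}"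
  have fin: "finite ?D"
    using assms by (simp add: decomposes_def)
  show ?thesis
  proof (rule decomposesI[OF fin])
    show "x - y = (\<Sum>d\<in>?D. c d - c' d)"
      using decomposes_sum_superset[OF assms(1) fin] decomposes_sum_superset[OF assms(2) fin]
      by (simp add: sum_subtractf)
  qed (use assms in \<open>auto simp: decomposes_def intro: add_subgroup_diff\<close>)
qed

context graded_group
begin

lemma hcomp_diff: "x \<in> X \<Longrightarrow> y \<in> X \<Longrightarrow> hcomp G (x - y) d = hcomp G x d - hcomp G y d"
  using hcomp_eqI[OF add_subgroup_diff[OF subgroup]
      decomposes_diff[OF decomposes_hcomp decomposes_hcomp grade_subgroup]] by simp

lemma hcomp_homog:
  assumes "x \<in> G d"
  shows "hcomp G x e = (if e = d then x else 0)"
proof -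
  have "decomposes G x (\<lambda>e. if e = d then x else 0)"
    by (rule decomposesI[of "{d}"]) (use assms in \<open>auto intro: add_subgroup_zero grade_subgroup\<close>)
  then show ?thesis
    using hcomp_eqI grade_mem[OF assms] by fastforce
qed

lemma hcomp_additive: "additive_on X (\<lambda>x. hcomp G x d)"
proof -
  have "hcomp G (x + y) d = hcomp G x d + hcomp G y d" if "x \<in> X" "y \<in> X" for x y
    using hcomp_diff[OF add_subgroup_add[OF subgroup that] that(2)]
    by (auto simp: algebra_simps)
  then show ?thesis
    by (simp add: additive_on_def)
qed

text \<open>Every element is the finite sum of its components, added one at a time. The empty sum
  falls under the homogeneous case, since 0 lies in every \<open>G d\<close>.\<close>

lemma homog_induct [consumes 1, case_names homog add]:
  assumes "x \<in> X"
    and "\<And>d x. x \<in> G d \<Longrightarrow> P x"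
    and "\<And>x y. x \<in> X \<Longrightarrow> y \<in> X \<Longrightarrow> P x \<Longrightarrow> P y \<Longrightarrow> P (x + y)"
  shows "P x"
proof -
  have "P (\<Sum>d\<in>D. hcomp G x d) \<and> (\<Sum>d\<in>D. hcomp G x d) \<in> X" if "finite D" for D
    using that
  proof induction
    case empty
    then show ?case
      using assms(2) add_subgroup_zero[OF grade_subgroup] add_subgroup_zero[OF subgroup] by auto
  next
    case (insert d D)
    then show ?case
      using assms(3) assms(2) hcomp_mem[OF assms(1), of d] grade_mem add_subgroup_add[OF subgroup]
      by (auto simp: insert)
  qed
  then show ?thesis
    using hcomp_finite[OF assms(1)] hcomp_sum[OF assms(1)] by force
qed

text \<open>The device by which identities with degree-dependent signs are reduced to homogeneous
  elements.\<close>

lemma additive_eqI: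
  assumes "additive_on X f" "additive_on X g" "\<And>d x. x \<in> G d \<Longrightarrow> f x = g x" "x \<in> X"
  shows "f x = g x"
  using assms(4) by (induction rule: homog_induct) (use assms(1-3) in \<open>auto simp: additive_on_add\<close>)

text \<open>Taking the component in degree \<open>u e\<close> annihilates every summand except the
  one at \<open>e\<close>, because \<open>u\<close> is injective on \<open>D\<close>.\<close>

lemma independent:
  assumes "finite D" "inj_on u D" "\<And>e. e \<in> D \<Longrightarrow> c e \<in> G (u e)" "(\<Sum>e\<in>D. c e) = 0" "e \<in> D"
  shows "c e = 0"
proof -
  have "0 = hcomp G (\<Sum>e\<in>D. c e) (u e)"
    using assms(4) hcomp_homog[OF add_subgroup_zero[OF grade_subgroup]] by simp
  also have "\<dots> = (\<Sum>i\<in>D. hcomp G (c i) (u e))"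
    by (rule additive_on_sum[OF hcomp_additive subgroup]) (use assms grade_mem in blast)
  also have "\<dots> = (\<Sum>i\<in>D. if i = e then c e else 0)"
    using assms(2,5) hcomp_homog[OF assms(3)] by (intro sum.cong) (auto simp: inj_on_def)
  also have "\<dots> = c e"
    using assms by simp
  finally show ?thesis ..
qed

text \<open>Each \<open>F d\<close> sends 0 to 0, so zero components contribute nothing. This lets
  two elements be compared over a common set of degrees.\<close>

lemma hext_superset:
  assumes "x \<in> X" "\<And>d. additive_on (G d) (F d)" "finite D" "{d. hcomp G x d \<noteq> 0} \<subseteq> D"
  shows "hext G F x = (\<Sum>d\<in>D. F d (hcomp G x d))"
  unfolding hext_def
  by (rule sum.mono_neutral_left)
    (use assms additive_on_zero[OF assms(2) add_subgroup_zero[OF grade_subgroup]] in auto)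

lemma hext_homog:
  assumes "\<And>d. additive_on (G d) (F d)" "x \<in> G d"
  shows "hext G F x = F d x"
  by (subst hext_superset[OF grade_mem[OF assms(2)] assms(1), of "{d}"])
    (simp_all add: hcomp_homog[OF assms(2)] subset_iff)

lemma hext_additive:
  assumes "\<And>d. additive_on (G d) (F d)"
  shows "additive_on X (hext G F)"
  unfolding additive_on_def
proof (intro ballI)
  fix x y assume x: "x \<in> X" and y: "y \<in> X"
  let ?D = "{d. hcomp G x d \<noteq> 0} \<union> {d. hcomp G y d \<noteq> 0}"
  note plus = additive_on_add[OF hcomp_additive x y]
  have fin: "finite ?D"
    using hcomp_finite x y by blast
  have "hext G F (x + y) = (\<Sum>d\<in>?D. F d (hcomp G (x + y) d))"
    by (rule hext_superset[OF add_subgroup_add[OF subgroup x y] assms fin]) (auto simp: plus)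
  also have "\<dots> = (\<Sum>d\<in>?D. F d (hcomp G x d) + F d (hcomp G y d))"
    using additive_on_add[OF assms] hcomp_mem x y plus by simp
  also have "\<dots> = hext G F x + hext G F y"
    using hext_superset[OF x assms fin] hext_superset[OF y assms fin] by (simp add: sum.distrib)
  finally show "hext G F (x + y) = hext G F x + hext G F y" .
qed

end

text \<open>Here \<open>x\<close> stays fixed and the formulas vary: this is how additivity in
  another variable passes through a nested \<open>hext\<close>.\<close>

lemma hext_plus_coefficients:
  assumes "\<And>d. K d (hcomp G x d) = F d (hcomp G x d) + F' d (hcomp G x d)"
  shows "hext G K x = hext G F x + hext G F' x"
  by (simp add: hext_def assms sum.distrib)

lemma hext_cong:
  assumes "\<And>d. F d (hcomp G x d) = F' d (hcomp G x d)"
  shows "hext G F x = hext G F' x"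
  by (simp add: hext_def assms)

section \<open>Internal direct sums and degree-preserving maps\<close>

lemma graded_by_internal_sum:
  assumes "\<And>d. add_subgroup (H d)"
    and unique: "\<And>x c c'. decomposes H x c \<Longrightarrow> decomposes H x c' \<Longrightarrow> c = c'"
  shows "graded_by (internal_sum H) H"
  unfolding graded_by_def
proof (intro conjI allI ballI)
  have "decomposes H 0 (\<lambda>_. 0)"
    by (rule decomposesI[of "{}"]) (use assms in \<open>auto intro: add_subgroup_zero\<close>)
  then show "add_subgroup (internal_sum H)"
    using decomposes_diff[of H, OF _ _ assms(1)]
    unfolding add_subgroup_def internal_sum_def mem_Collect_eq by blast
  show "H d \<subseteq> internal_sum H" for d
  proof
    fix x assume "x \<in> H d"
    then have "decomposes H x (\<lambda>e. if e = d then x else 0)"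
      by (intro decomposesI[of "{d}"]) (use assms in \<open>auto intro: add_subgroup_zero\<close>)
    then show "x \<in> internal_sum H"
      by (auto simp: internal_sum_def)
  qed
  show "\<exists>!c. decomposes H x c" if "x \<in> internal_sum H" for x
    using that unique by (auto simp: internal_sum_def)
qed (rule assms)

locale graded_group_pair = X: graded_group X G + Y: graded_group Y H
  for X :: "'m::ab_group_add set" and G :: "'l deg \<Rightarrow> 'm set"
    and Y :: "'n::ab_group_add set" and H :: "'l deg \<Rightarrow> 'n set"
begin

lemma graded_additive_mem:
  assumes "additive_on X f" "\<And>d. f ` G d \<subseteq> H d" "x \<in> X"
  shows "f x \<in> Y"
  using assms(3)
proof (induction rule: X.homog_induct)
  case (homog d x)
  then show ?case
    using assms(2) Y.grade_mem by blast
next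
  case (add x y)
  then show ?case
    using assms(1) add_subgroup_add[OF Y.subgroup] by (auto simp: additive_on_add)
qed

text \<open>Both sides are additive in \<open>x\<close>, and on a homogeneous element each is either
  its image or 0.\<close>

lemma hcomp_map:
  assumes "additive_on X f" "\<And>d. f ` G d \<subseteq> H d" "x \<in> X"
  shows "hcomp H (f x) d = f (hcomp G x d)"
proof (rule X.additive_eqI[OF _ _ _ assms(3)])
  show "additive_on X (\<lambda>x. hcomp H (f x) d)"
    unfolding additive_on_def using graded_additive_mem[OF assms(1,2)]
    by (auto simp: additive_on_add[OF assms(1)] additive_on_add[OF Y.hcomp_additive])
  show "additive_on X (\<lambda>x. f (hcomp G x d))"
    unfolding additive_on_def
    by (simp add: additive_on_add[OF assms(1) X.grade_mem X.grade_mem, OF X.hcomp_mem X.hcomp_mem]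
        additive_on_add[OF X.hcomp_additive])
  show "hcomp H (f x) d = f (hcomp G x d)" if "x \<in> G e" for e x
    using that assms(2)[of e] additive_on_zero[OF assms(1) add_subgroup_zero[OF X.subgroup]]
    by (auto simp: X.hcomp_homog[OF that] Y.hcomp_homog[of "f x" e])
qed

text \<open>By \<open>hcomp_map\<close>, \<open>f\<close> takes the same value at \<open>x\<close>
  and at its component in degree \<open>d\<close>, so injectivity identifies them. This controls
  degrees of preimages: under the automorphisms, and of the elements that represent homogeneous
  maps.\<close>

lemma graded_bij_reflects:
  assumes "additive_on X f" "\<And>d. f ` G d \<subseteq> H d" "inj_on f X" "x \<in> X" "f x \<in> H d"
  shows "x \<in> G d"
proof -
  have "f (hcomp G x d) = f x"
    using hcomp_map[OF assms(1,2,4), of d] Y.hcomp_homog[OF assms(5)] by simp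
  then have "hcomp G x d = x"
    using inj_onD[OF assms(3) _ X.grade_mem[OF X.hcomp_mem[OF assms(4)]] assms(4)] by simp
  then show ?thesis
    using X.hcomp_mem[OF assms(4), of d] by simp
qed

text \<open>An element of the kernel has all its components in the kernel, and every element of
  \<open>Y\<close> is a sum of homogeneous ones; so kernel and image are tested degree by
  degree.\<close>

lemma graded_bijI:
  assumes "additive_on X f" "\<And>d. f ` G d \<subseteq> H d"
    and inj: "\<And>d x. x \<in> G d \<Longrightarrow> f x = 0 \<Longrightarrow> x = 0"
    and surj: "\<And>d y. y \<in> H d \<Longrightarrow> \<exists>x\<in>G d. f x = y"
  shows "bij_betw f X Y"
  unfolding bij_betw_def
proof
  show "inj_on f X"
  proof (rule inj_onI)
    fix x y assume xy: "x \<in> X" "y \<in> X" "f x = f y"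
    then have z: "x - y \<in> X" "f (x - y) = 0"
      using add_subgroup_diff[OF X.subgroup] additive_on_diff[OF assms(1) X.subgroup] by auto
    have "hcomp G (x - y) d = 0" for d
      using hcomp_map[OF assms(1,2) z(1), of d]
        Y.hcomp_homog[OF add_subgroup_zero[OF Y.grade_subgroup[of d]], of d]
      by (intro inj[OF X.hcomp_mem[OF z(1)]]) (simp add: z(2))
    then show "x = y"
      using X.hcomp_sum[OF z(1)] by simp
  qed
  have "y \<in> f ` X" if "y \<in> Y" for y
    using that
  proof (induction rule: Y.homog_induct)
    case (homog d y)
    then show ?case
      using surj X.grade_mem by blast
  next
    case (add y z)
    then obtain u v where "u \<in> X" "v \<in> X" "y = f u" "z = f v"
      by auto
    then have "y + z = f (u + v)" "u + v \<in> X"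
      using additive_on_add[OF assms(1)] add_subgroup_add[OF X.subgroup] by auto
    then show ?case
      by blast
  qed
  then show "f ` X = Y"
    using graded_additive_mem[OF assms(1,2)] by blast
qed

end

section \<open>Sign twists\<close>

text \<open>\<open>S\<close> is the shift \<open>(\<lambda>, \<pi>)\<close>.\<close>

locale twisted_extension =
  fixes GA :: "'l::ab_group_add deg \<Rightarrow> 'a::{ring,monoid_mult} set"
    and B :: "'a set" and \<alpha> \<beta> :: "'a \<Rightarrow> 'a" and S :: "'l deg"
  assumes superring_A: "graded_superring UNIV GA"
    and subring_B: "graded_subring GA B"
    and aut_\<alpha>: "graded_automorphism UNIV GA \<alpha>"
    and aut_\<beta>: "graded_automorphism B (sub_grading GA B) \<beta>"
begin

abbreviation GB :: "'l deg \<Rightarrow> 'a set" where "GB \<equiv> sub_grading GA B"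

section \<open>The ring and its subring as graded groups\<close>

sublocale A: graded_group UNIV GA
  by standard (use superring_A in \<open>simp add: graded_superring_def\<close>)

sublocale B: graded_group B GB
  by standard (use subring_B in \<open>simp add: graded_subring_def graded_superring_def\<close>)

sublocale BB: graded_group_pair B GB B GB ..
sublocale AA: graded_group_pair UNIV GA UNIV GA ..

lemma GB_iff: "x \<in> GB d \<longleftrightarrow> x \<in> B \<and> x \<in> GA d"
  by (simp add: sub_grading_def)

lemma mult_mem: "x \<in> GA d \<Longrightarrow> y \<in> GA e \<Longrightarrow> x * y \<in> GA (d + e)"
  using superring_A by (simp add: graded_superring_def)

text \<open>The grading axiom speaks of homogeneous factors; distributivity extends it one factor at
  a time.\<close>

lemma B_mult:
  assumes "x \<in> B" "y \<in> B"
  shows "x * y \<in> B"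
  using assms(1)
proof (induction rule: B.homog_induct)
  case (homog d x)
  show ?case
    using assms(2)
  proof (induction rule: B.homog_induct)
    case (homog e y)
    then show ?case
      using subring_B \<open>x \<in> GB d\<close> B.grade_mem
      unfolding graded_subring_def graded_superring_def by blast
  qed (simp add: distrib_left add_subgroup_add[OF B.subgroup])
qed (simp add: distrib_right add_subgroup_add[OF B.subgroup])

lemma B_one: "1 \<in> B"
  using subring_B by (simp add: graded_subring_def graded_superring_def)

text \<open>The degree 0 component of 1 acts as a left unit on every homogeneous element, hence is 1.\<close>

lemma one_mem: "1 \<in> GA 0"
proof -
  let ?u = "hcomp GA 1"
  have "?u 0 * x = x" for x
  proof (rule A.additive_eqI[of "\<lambda>x. ?u 0 * x" "\<lambda>x. x"])
    fix d x assume x: "x \<in> GA d"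
    have "x = (\<Sum>e | ?u e \<noteq> 0. ?u e) * x"
      using A.hcomp_sum[of 1] by simp
    also have "\<dots> = (\<Sum>e | ?u e \<noteq> 0. ?u e * x)"
      by (rule sum_distrib_right)
    finally have dec: "decomposes GA x (\<lambda>e. ?u (e - d) * x)"
      using A.hcomp_finite[of 1] mult_mem[OF A.hcomp_mem[of 1] x]
    proof (intro decomposesI[of "(\<lambda>e. e + d) ` {e. ?u e \<noteq> 0}"])
      show "?u (e - d) * x \<in> GA e" for e
        using mult_mem[OF A.hcomp_mem[of 1] x, of "e - d"] by simp
      show "?u (e - d) * x = 0" if "e \<notin> (\<lambda>e. e + d) ` {e. ?u e \<noteq> 0}" for e
      proof -
        have "?u (e - d) = 0"
          using that by (rule contrapos_np) (auto intro: image_eqI[of _ _ "e - d"])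
        then show ?thesis
          by simp
      qed
    qed (auto simp: sum.reindex)
    \<comment> \<open>Uniqueness of components: in degree \<open>d\<close> the homogeneous
      \<open>x\<close> has component \<open>x\<close>, while the decomposition \<open>dec\<close>
      has \<open>?u 0 * x\<close> there.\<close>
    then show "?u 0 * x = x"
      using A.hcomp_eqI[OF _ dec] A.hcomp_homog[OF x, of d] by (metis UNIV_I diff_self)
  qed (auto simp: additive_on_def distrib_left)
  from this[of 1] show ?thesis
    using A.hcomp_mem[of 1 0] by simp
qed

lemma B_one_mem: "1 \<in> GB 0"
  by (simp add: GB_iff one_mem B_one)

section \<open>The parity automorphism\<close>

definition sg :: "bit \<Rightarrow> 'a \<Rightarrow> 'a" where
  "sg \<gamma> = hext GA (\<lambda>d. signed (\<gamma> * snd d))"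

lemma sg_homog: "x \<in> GA d \<Longrightarrow> sg \<gamma> x = signed (\<gamma> * snd d) x"
  unfolding sg_def by (rule A.hext_homog) (auto simp: additive_on_def signed_plus)

lemma sg_additive: "additive_on UNIV (sg \<gamma>)"
  unfolding sg_def by (rule A.hext_additive) (auto simp: additive_on_def signed_plus)

lemma sg_plus: "sg \<gamma> (x + y) = sg \<gamma> x + sg \<gamma> y"
  by (rule additive_on_add[OF sg_additive]) auto

lemma sg_mem: "x \<in> GA d \<Longrightarrow> sg \<gamma> x \<in> GA d"
  by (simp add: sg_homog signed_mem A.grade_subgroup)

lemma sg_zero [simp]: "sg \<gamma> 0 = 0"
  using additive_on_zero[OF sg_additive] by simp

lemma sg_sum: "sg \<gamma> (\<Sum>i\<in>I. f i) = (\<Sum>i\<in>I. sg \<gamma> (f i))"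
  by (rule additive_on_sum[OF sg_additive]) auto

lemma sg_B:
  assumes "b \<in> B"
  shows "sg \<gamma> b \<in> B"
  using assms
proof (induction rule: B.homog_induct)
  case (homog d b)
  then show ?case
    using sg_homog[of b d] signed_mem[OF B.subgroup, of b] by (simp add: GB_iff)
qed (simp add: sg_plus add_subgroup_add[OF B.subgroup])

lemma sg_GB: "b \<in> GB d \<Longrightarrow> sg \<gamma> b \<in> GB d"
  by (simp add: GB_iff sg_B sg_mem)

lemma sg_sg: "sg \<gamma> (sg \<delta> x) = sg (\<gamma> + \<delta>) x"
proof (rule A.additive_eqI[of "\<lambda>x. sg \<gamma> (sg \<delta> x)" "sg (\<gamma> + \<delta>)"])
  show "sg \<gamma> (sg \<delta> x) = sg (\<gamma> + \<delta>) x" if "x \<in> GA d" for d x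
    using sg_homog[OF that] sg_homog[OF signed_mem[OF A.grade_subgroup that]]
    by (simp add: signed_signed distrib_right)
qed (auto simp: additive_on_def sg_plus)

lemma sg_0 [simp]: "sg 0 x = x"
  by (rule A.additive_eqI[of "sg 0" "\<lambda>x. x"]) (auto simp: additive_on_def sg_plus sg_homog)

lemma sg_twice [simp]: "sg \<gamma> (sg \<gamma> x) = x"
  by (simp add: sg_sg)

text \<open>Parities add under multiplication, so the signs of the factors multiply to the sign of
  the product.\<close>

lemma sg_mult: "sg \<gamma> (x * y) = sg \<gamma> x * sg \<gamma> y"
proof (rule A.additive_eqI[of "\<lambda>x. sg \<gamma> (x * y)" "\<lambda>x. sg \<gamma> x * sg \<gamma> y"])
  fix d x assume x: "x \<in> GA d"
  show "sg \<gamma> (x * y) = sg \<gamma> x * sg \<gamma> y"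
  proof (rule A.additive_eqI[of "\<lambda>y. sg \<gamma> (x * y)" "\<lambda>y. sg \<gamma> x * sg \<gamma> y"])
    show "sg \<gamma> (x * y) = sg \<gamma> x * sg \<gamma> y" if y: "y \<in> GA e" for e y
      using sg_homog[OF mult_mem[OF x y]] x y
      by (simp add: sg_homog signed_mult_left signed_mult_right signed_signed distrib_left add.commute)
  qed (auto simp: additive_on_def sg_plus distrib_left)
qed (auto simp: additive_on_def sg_plus distrib_right)

lemma sg_graded_map:
  assumes "additive_on B f" "\<And>d. f ` GB d \<subseteq> GB d" "b \<in> B"
  shows "f (sg \<gamma> b) = sg \<gamma> (f b)"
proof (rule B.additive_eqI[OF _ _ _ assms(3)])
  show "additive_on B (\<lambda>b. f (sg \<gamma> b))" "additive_on B (\<lambda>b. sg \<gamma> (f b))"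
    using assms(1) sg_B by (auto simp: additive_on_def sg_plus)
  fix d x assume x: "x \<in> GB d"
  then have "f x \<in> GB d"
    using assms(2)[of d] by blast
  with x show "f (sg \<gamma> x) = sg \<gamma> (f x)"
    using sg_homog[of x d] sg_homog[of "f x" d]
    by (simp add: GB_iff signed_additive[OF assms(1) B.subgroup])
qed

text \<open>Rewrites the left action of a shift: summed over the components of \<open>b\<close>, the
  sign becomes \<open>sg \<gamma>\<close> applied to \<open>b\<close>.\<close>

lemma hext_signed_mult:
  assumes "b \<in> B"
  shows "hext GB (\<lambda>d b'. signed (\<gamma> * snd d) (b' * m)) b = sg \<gamma> b * m"
proof (rule B.additive_eqI[OF _ _ _ assms])
  show "additive_on B (hext GB (\<lambda>d b'. signed (\<gamma> * snd d) (b' * m)))"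
    by (rule B.hext_additive) (simp add: additive_on_def distrib_right signed_plus)
  show "hext GB (\<lambda>d b'. signed (\<gamma> * snd d) (b' * m)) b = sg \<gamma> b * m" if "b \<in> GB d" for b d
    using that by (subst B.hext_homog[of _ _ d])
      (auto simp: additive_on_def distrib_right signed_plus GB_iff sg_homog signed_mult_left)
qed (simp add: additive_on_def sg_plus distrib_right)

section \<open>The two automorphisms and their inverses\<close>

lemma \<alpha>_bij: "bij \<alpha>" and \<alpha>_additive: "additive_on UNIV \<alpha>"
  and \<alpha>_mult: "\<alpha> (x * y) = \<alpha> x * \<alpha> y"
  and \<alpha>_image: "\<alpha> ` GA d \<subseteq> GA d"
  using aut_\<alpha> by (auto simp: graded_automorphism_def)

lemma \<beta>_bij: "bij_betw \<beta> B B" and \<beta>_additive: "additive_on B \<beta>"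
  and \<beta>_mult: "x \<in> B \<Longrightarrow> y \<in> B \<Longrightarrow> \<beta> (x * y) = \<beta> x * \<beta> y"
  and \<beta>_image: "\<beta> ` GB d \<subseteq> GB d"
  using aut_\<beta> by (auto simp: graded_automorphism_def)

definition \<alpha>' :: "'a \<Rightarrow> 'a" where "\<alpha>' = inv \<alpha>"

definition \<beta>' :: "'a \<Rightarrow> 'a" where "\<beta>' = inv_into B \<beta>"

lemma \<alpha>_mem: "x \<in> GA d \<Longrightarrow> \<alpha> x \<in> GA d"
  using \<alpha>_image by blast

lemma \<alpha>_inv [simp]: "\<alpha> (\<alpha>' x) = x" and inv_\<alpha> [simp]: "\<alpha>' (\<alpha> x) = x"
  using \<alpha>_bij by (auto simp: \<alpha>'_def bij_def surj_f_inv_f)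

lemma \<alpha>_plus: "\<alpha> (x + y) = \<alpha> x + \<alpha> y"
  using \<alpha>_additive by (simp add: additive_on_def)

lemma \<alpha>_zero [simp]: "\<alpha> 0 = 0"
  using additive_on_zero[OF \<alpha>_additive] by simp

lemma \<alpha>_sum: "\<alpha> (\<Sum>i\<in>I. f i) = (\<Sum>i\<in>I. \<alpha> (f i))"
  by (rule additive_on_sum[OF \<alpha>_additive]) auto

lemma \<alpha>'_plus: "\<alpha>' (x + y) = \<alpha>' x + \<alpha>' y"
  by (metis \<alpha>_plus \<alpha>_inv inv_\<alpha>)

lemma \<alpha>'_mult: "\<alpha>' (x * y) = \<alpha>' x * \<alpha>' y"
  by (metis \<alpha>_mult \<alpha>_inv inv_\<alpha>)

lemma \<alpha>'_sum: "\<alpha>' (\<Sum>i\<in>I. f i) = (\<Sum>i\<in>I. \<alpha>' (f i))"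
  by (rule additive_on_sum[of UNIV]) (auto simp: additive_on_def \<alpha>'_plus)

text \<open>\<open>graded_automorphism\<close> asks that \<open>\<alpha>\<close> map each
  \<open>GA d\<close> into itself; that the inverse does so too comes from injectivity.\<close>

lemma \<alpha>'_mem: "x \<in> GA d \<Longrightarrow> \<alpha>' x \<in> GA d"
  using AA.graded_bij_reflects[OF \<alpha>_additive \<alpha>_image, of "\<alpha>' x" d] \<alpha>_bij by (simp add: bij_def)

lemma \<beta>_B: "b \<in> B \<Longrightarrow> \<beta> b \<in> B" and \<beta>'_B: "b \<in> B \<Longrightarrow> \<beta>' b \<in> B"
  and \<beta>_inv [simp]: "b \<in> B \<Longrightarrow> \<beta> (\<beta>' b) = b" and inv_\<beta> [simp]: "b \<in> B \<Longrightarrow> \<beta>' (\<beta> b) = b"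
  using \<beta>_bij unfolding \<beta>'_def
  by (auto simp: bij_betw_def inv_into_into f_inv_into_f)

lemma \<beta>_mem: "b \<in> GB d \<Longrightarrow> \<beta> b \<in> GB d"
  using \<beta>_image by blast

lemma \<beta>'_mem: "b \<in> GB d \<Longrightarrow> \<beta>' b \<in> GB d"
  using BB.graded_bij_reflects[OF \<beta>_additive \<beta>_image, of "\<beta>' b" d] \<beta>_bij
  by (simp add: bij_betw_def GB_iff \<beta>'_B)

lemma \<beta>_plus: "x \<in> B \<Longrightarrow> y \<in> B \<Longrightarrow> \<beta> (x + y) = \<beta> x + \<beta> y"
  using \<beta>_additive by (simp add: additive_on_def)

lemma \<beta>'_plus: "x \<in> B \<Longrightarrow> y \<in> B \<Longrightarrow> \<beta>' (x + y) = \<beta>' x + \<beta>' y"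
  by (metis \<beta>_plus \<beta>'_B \<beta>_inv inv_\<beta> add_subgroup_add[OF B.subgroup])

lemma \<beta>'_mult: "x \<in> B \<Longrightarrow> y \<in> B \<Longrightarrow> \<beta>' (x * y) = \<beta>' x * \<beta>' y"
  by (metis \<beta>_mult \<beta>'_B \<beta>_inv inv_\<beta> B_mult)

lemma \<beta>'_additive: "additive_on B \<beta>'"
  by (simp add: additive_on_def \<beta>'_plus)

lemma \<beta>_sg: "b \<in> B \<Longrightarrow> \<beta> (sg \<gamma> b) = sg \<gamma> (\<beta> b)"
  by (rule sg_graded_map[OF \<beta>_additive \<beta>_image])

lemma \<beta>'_sg: "b \<in> B \<Longrightarrow> \<beta>' (sg \<gamma> b) = sg \<gamma> (\<beta>' b)"
  by (rule sg_graded_map[OF \<beta>'_additive]) (auto simp: \<beta>'_mem)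

section \<open>The HOM bimodules\<close>


definition hmap :: "'l deg \<Rightarrow> ('a \<Rightarrow> 'a) \<Rightarrow> bool" where
  "hmap k h \<longleftrightarrow> additive_on UNIV h \<and> (\<forall>d. h ` GA d \<subseteq> GB (d + k))"

lemma hmap_additive: "hmap k h \<Longrightarrow> additive_on UNIV h"
  by (simp add: hmap_def)

lemma hmap_plus: "hmap k h \<Longrightarrow> h (x + y) = h x + h y"
  by (simp add: hmap_def additive_on_def)

lemma hmap_sum: "hmap k h \<Longrightarrow> h (\<Sum>i\<in>I. f i) = (\<Sum>i\<in>I. h (f i))"
  by (rule additive_on_sum[of UNIV]) (auto simp: hmap_def)

lemma hmap_signed: "hmap k h \<Longrightarrow> h (signed \<gamma> x) = signed \<gamma> (h x)"
  by (rule signed_additive[of UNIV]) (auto simp: hmap_def)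

lemma hmap_mem: "hmap k h \<Longrightarrow> x \<in> GA d \<Longrightarrow> e = d + k \<Longrightarrow> h x \<in> GB e"
  by (auto simp: hmap_def)

lemma hmap_B: assumes "hmap k h" shows "h x \<in> B"
proof -
  have "x \<in> UNIV"
    by simp
  then show ?thesis
  proof (induction rule: A.homog_induct)
    case (homog d x)
    then show ?case
      using hmap_mem[OF assms _ refl] B.grade_mem by blast
  qed (simp add: hmap_plus[OF assms] add_subgroup_add[OF B.subgroup])
qed

lemma hmapI:
  assumes "\<And>x y. h (x + y) = h x + h y" "\<And>d x. x \<in> GA d \<Longrightarrow> h x \<in> GB (d + k)"
  shows "hmap k h"
  using assms by (auto simp: hmap_def additive_on_def)

lemma hmap_subgroup: "add_subgroup {h. hmap k h}"
  using add_subgroup_zero[OF B.grade_subgroup] add_subgroup_diff[OF B.grade_subgroup]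
  by (auto simp: add_subgroup_def hmap_def additive_on_def image_subset_iff)

text \<open>The difference of two decompositions is a vanishing sum of maps. Its values at an
  \<open>x\<close> of degree \<open>d\<close> have the distinct degrees \<open>d + (e - k)\<close>
  in \<open>B\<close>, so each of them is 0.\<close>

lemma graded_by_hmaps:
  assumes "\<And>e. add_subgroup (H e)" "\<And>e f. f \<in> H e \<Longrightarrow> hmap (e - k) f"
  shows "graded_by (internal_sum H) H"
proof (rule graded_by_internal_sum[OF assms(1)])
  fix f c c' assume "decomposes H f c" "decomposes H f c'"
  note dec = decomposes_diff[OF this assms(1)]
  let ?c = "\<lambda>e. c e - c' e"
  let ?D = "{e. ?c e \<noteq> 0}"
  have c: "hmap (e - k) (?c e)" for e
    using dec assms(2) by (simp add: decomposes_def)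
  have f0: "(\<Sum>e\<in>?D. ?c e) = 0"
    using dec by (simp add: decomposes_def)
  show "c = c'"
  proof
    fix e
    have "?c e x = 0" for x
    proof (rule A.additive_eqI[of "?c e" "\<lambda>x. 0"])
      fix d x assume x: "x \<in> GA d"
      have "?c e x = 0" if "e \<in> ?D"
      proof (rule B.independent[where u = "\<lambda>e. d + (e - k)" and D = ?D and c = "\<lambda>e. ?c e x"])
        show "(\<Sum>e\<in>?D. ?c e x) = 0"
          using fun_cong[OF f0, of x] by (simp add: sum_fun_apply)
        show "finite ?D"
          using dec by (simp add: decomposes_def)
        show "?c i x \<in> GB (d + (i - k))" for i
          by (rule hmap_mem[OF c x refl])
      qed (use that in \<open>simp_all add: inj_on_def\<close>)
      then show "?c e x = 0"
        by (cases "?c e = 0") (simp_all add: fun_eq_iff)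
    qed (use hmap_additive[OF c] in \<open>auto simp: additive_on_def\<close>)
    then show "c e = c' e"
      by (auto simp: fun_eq_iff)
  qed
qed

lemma internal_sum_additive:
  assumes "f \<in> internal_sum H" "\<And>e f. f \<in> H e \<Longrightarrow> hmap (e - k) f"
  shows "additive_on UNIV f"
proof -
  obtain c where "decomposes H f c"
    using assms(1) by (auto simp: internal_sum_def)
  then have f: "f = (\<Sum>e | c e \<noteq> 0. c e)" and c: "hmap (e - k) (c e)" for e
    using assms(2) by (auto simp: decomposes_def)
  show ?thesis
    by (subst f) (simp add: additive_on_def sum_fun_apply hmap_plus[OF c] sum.distrib)
qed

section \<open>The two groups of semilinear maps\<close>

abbreviation N :: "('l, 'a, 'a, 'a) bimodule" where "N \<equiv> shift GB S (mult_bimodule B GB)"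

abbreviation L :: "'l deg \<Rightarrow> ('a \<Rightarrow> 'a) set" where
  "L \<equiv> left_maps GB (twisted_bimodule UNIV GA \<beta> \<alpha>) N"

abbreviation R :: "'l deg \<Rightarrow> ('a \<Rightarrow> 'a) set" where
  "R \<equiv> right_maps B (twisted_bimodule UNIV GA \<alpha>' \<beta>') N"

abbreviation HL :: "('l, 'a, 'a, 'a \<Rightarrow> 'a) bimodule" where
  "HL \<equiv> HOM_left GA GB (twisted_bimodule UNIV GA \<beta> \<alpha>) N"

abbreviation HR :: "('l, 'a, 'a, 'a \<Rightarrow> 'a) bimodule" where
  "HR \<equiv> HOM_right B (twisted_bimodule UNIV GA \<alpha>' \<beta>') N"

text \<open>\<open>shift\<close> adds the parity where it subtracts the other degree; in Z/2 the two
  agree, so the grading is translated by all of \<open>k\<close>.\<close>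

lemma grade_N: "grade (shift GB k (mult_bimodule B GB)) d = GB (d - k)"
  by (cases k; cases d) (simp add: shift_def mult_bimodule_def minus_bit_def)

lemma lact_N: "b \<in> B \<Longrightarrow> lact (shift GB k (mult_bimodule B GB)) b m = sg (snd k) b * m"
  by (cases k) (simp add: shift_def mult_bimodule_def hext_signed_mult)

lemma ract_N: "ract (shift GB k (mult_bimodule B GB)) m b = m * b"
  by (cases k) (simp add: shift_def mult_bimodule_def)

text \<open>Degrees of maps are taken in the shifted grading of \<open>N\<close>, whereas
  \<open>hmap\<close> uses that of \<open>B\<close>; hence the offset by \<open>S\<close>.\<close>

lemma hmap_iff: "f \<in> maps_of_degree (twisted_bimodule UNIV GA \<rho> \<sigma>) N e \<longleftrightarrow> hmap (e - S) f"
  by (simp add: maps_of_degree_def hmap_def grade_N twisted_bimodule_def add_diff_eq)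

text \<open>Two signs meet: one for moving a map of degree \<open>e\<close> past \<open>b\<close>,
  one from the shifted left action. Both exponents are multiples of the parity of \<open>b\<close>,
  so the signs merge into a single \<open>sg\<close>.\<close>

lemma L_iff:
  "f \<in> L e \<longleftrightarrow> hmap (e - S) f \<and> (\<forall>b\<in>B. \<forall>x. f (\<beta> b * x) = sg (snd e + snd S) b * f x)"
  (is "_ \<longleftrightarrow> _ \<and> ?lin")
proof -
  have "(\<forall>d. \<forall>b\<in>GB d. \<forall>x. f (\<beta> b * x) = signed (snd e * snd d) (sg (snd S) b * f x)) \<longleftrightarrow> ?lin"
    (is "?hom \<longleftrightarrow> _") if f: "hmap (e - S) f"
  proof -
    have sg: "signed (snd e * snd d) (sg (snd S) b * f x) = sg (snd e + snd S) b * f x"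
      if "b \<in> GB d" for b d x
      using that sg_homog[of b d]
      by (simp add: GB_iff signed_mult_left signed_signed distrib_right)
    show ?thesis
    proof
      assume ?hom
      then have hom: "f (\<beta> b * x) = sg (snd e + snd S) b * f x" if "b \<in> GB d" for b d x
        using that sg by auto
      show ?lin
      proof (intro ballI allI)
        fix b x assume "b \<in> B"
        then show "f (\<beta> b * x) = sg (snd e + snd S) b * f x"
          by (rule B.additive_eqI[rotated 3])
            (simp_all add: additive_on_def \<beta>_plus sg_plus distrib_right hmap_plus[OF f] hom)
      qed
    qed (auto simp: sg intro: B.grade_mem)
  qed
  moreover have "f \<in> L e \<longleftrightarrow> hmap (e - S) f
      \<and> (\<forall>d. \<forall>b\<in>GB d. \<forall>x. f (\<beta> b * x) = signed (snd e * snd d) (sg (snd S) b * f x))"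
    unfolding left_maps_def
    by (simp add: hmap_iff) (auto simp: twisted_bimodule_def lact_N B.grade_mem)
  ultimately show ?thesis
    by blast
qed

lemma R_iff: "f \<in> R e \<longleftrightarrow> hmap (e - S) f \<and> (\<forall>b\<in>B. \<forall>x. f (x * \<beta>' b) = f x * b)"
  unfolding right_maps_def by (simp add: hmap_iff) (simp add: twisted_bimodule_def ract_N)

lemma add_subgroup_L: "add_subgroup (L e)"
  unfolding add_subgroup_def
  using add_subgroup_zero[OF hmap_subgroup] add_subgroup_diff[OF hmap_subgroup]
  by (auto simp: L_iff right_diff_distrib)

lemma add_subgroup_R: "add_subgroup (R e)"
  unfolding add_subgroup_def
  using add_subgroup_zero[OF hmap_subgroup] add_subgroup_diff[OF hmap_subgroup]
  by (auto simp: R_iff left_diff_distrib)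

sublocale L: graded_group "internal_sum L" L
  by standard (rule graded_by_hmaps[OF add_subgroup_L, where k = S], simp add: L_iff)

sublocale R: graded_group "internal_sum R" R
  by standard (rule graded_by_hmaps[OF add_subgroup_R, where k = S], simp add: R_iff)

sublocale AL: graded_group_pair UNIV GA "internal_sum L" L ..
sublocale AR: graded_group_pair UNIV GA "internal_sum R" R ..

section \<open>The actions on the HOM bimodules\<close>

lemma L_additive: "f \<in> internal_sum L \<Longrightarrow> additive_on UNIV f"
  by (rule internal_sum_additive) (auto simp: L_iff)

text \<open>The sign in the parity of \<open>x\<close> is absorbed by \<open>sg\<close> in the
  argument, which removes the innermost of three sums. Those over the components of \<open>a\<close>
  and \<open>f\<close> stay.\<close>

lemma lact_HL:
  assumes "f \<in> internal_sum L"
  shows "lact HL a f x = hext GA (\<lambda>p a'. hext L (\<lambda>q f'.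
    signed (snd p * snd q) (f' (sg (snd p) x * \<alpha> a'))) f) a"
proof -
  have "hext GA (\<lambda>r x'. signed (snd p * snd q + snd p * snd r) (f' (x' * \<alpha> a'))) x
      = signed (snd p * snd q) (f' (sg (snd p) x * \<alpha> a'))"
    if f': "hmap k f'" for p q k f' a'
  proof (rule A.additive_eqI[of _ "\<lambda>x. signed (snd p * snd q) (f' (sg (snd p) x * \<alpha> a'))"])
    show "additive_on UNIV
        (hext GA (\<lambda>r x'. signed (snd p * snd q + snd p * snd r) (f' (x' * \<alpha> a'))))"
      by (rule A.hext_additive) (simp add: additive_on_def distrib_right signed_plus hmap_plus[OF f'])
    fix r x assume "x \<in> GA r"
    then show "hext GA (\<lambda>r x'. signed (snd p * snd q + snd p * snd r) (f' (x' * \<alpha> a'))) x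
      = signed (snd p * snd q) (f' (sg (snd p) x * \<alpha> a'))"
      by (subst A.hext_homog[of _ _ r])
        (simp_all add: additive_on_def distrib_right signed_plus hmap_plus[OF f'] sg_homog
          signed_mult_left hmap_signed[OF f'] signed_signed)
  qed (simp_all add: additive_on_def distrib_right signed_plus hmap_plus[OF f'] sg_plus)
  note inner = this
  have f: "hmap (q - S) (hcomp L f q)" for q
    using L.hcomp_mem[OF assms, of q] by (simp add: L_iff)
  have twisted: "grade (twisted_bimodule UNIV GA \<beta> \<alpha>) = GA"
    "ract (twisted_bimodule UNIV GA \<beta> \<alpha>) x a = x * \<alpha> a" for x a
    by (simp_all add: twisted_bimodule_def)
  show ?thesis
    by (simp add: HOM_left_def twisted) (intro hext_cong inner[OF f])
qed

text \<open>Together with \<open>lact_HL_additive_right\<close>, this reduces identities for the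
  left action to homogeneous \<open>a\<close> and \<open>f\<close>.\<close>

lemma lact_HL_additive_left:
  assumes "f \<in> internal_sum L"
  shows "additive_on UNIV (\<lambda>a. lact HL a f x)"
proof -
  have "hmap (q - S) (hcomp L f q)" for q
    using L.hcomp_mem[OF assms] by (simp add: L_iff)
  note plus = hmap_plus[OF this]
  have "additive_on UNIV (hext GA (\<lambda>p a'. hext L (\<lambda>q f'.
    signed (snd p * snd q) (f' (sg (snd p) x * \<alpha> a'))) f))"
    by (rule A.hext_additive)
      (auto simp: additive_on_def \<alpha>_plus distrib_left plus signed_plus intro!: hext_plus_coefficients)
  then show ?thesis
    by (simp add: lact_HL[OF assms])
qed

lemma lact_HL_additive_right: "additive_on (internal_sum L) (\<lambda>f. lact HL a f x)"
proof -
  have add: "additive_on (internal_sum L)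
      (hext L (\<lambda>q f'. signed (snd p * snd q) (f' (sg (snd p) x * \<alpha> a'))))" for p :: "'l deg" and a'
    by (rule L.hext_additive) (simp add: additive_on_def signed_plus)
  show ?thesis
    unfolding additive_on_def
    by (auto simp: lact_HL add_subgroup_add[OF L.subgroup] additive_on_add[OF add]
        intro!: hext_plus_coefficients)
qed

lemma lact_HL_homog:
  assumes "a \<in> GA p" "f \<in> L q"
  shows "lact HL a f x = signed (snd p * snd q) (f (sg (snd p) x * \<alpha> a))"
proof -
  have f: "hmap (q - S) f"
    using assms by (simp add: L_iff)
  have in_L: "hext L (\<lambda>q f'. signed (snd p * snd q) (f' (sg (snd p) x * \<alpha> a'))) f
      = signed (snd p * snd q) (f (sg (snd p) x * \<alpha> a'))" for p :: "'l deg" and a'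
    by (rule L.hext_homog[OF _ assms(2)]) (simp add: additive_on_def signed_plus)
  show ?thesis
    unfolding lact_HL[OF L.grade_mem[OF assms(2)]] in_L
    by (rule A.hext_homog[OF _ assms(1)])
      (simp add: additive_on_def \<alpha>_plus distrib_left hmap_plus[OF f] signed_plus)
qed

text \<open>As for the left action, \<open>sg\<close> absorbs the sign in the parity of
  \<open>x\<close>; the sum over the components of \<open>b\<close> remains.\<close>

lemma ract_HL:
  assumes "f \<in> internal_sum L"
  shows "ract HL f b x = hext GB (\<lambda>p b'. f (sg (snd p) x) * b') b"
proof -
  note f = L_additive[OF assms]
  have plus: "f (y + z) = f y + f z" for y z
    using f by (simp add: additive_on_def)
  have "hext GA (\<lambda>r x'. signed (snd p * snd r) (f x' * b')) x = f (sg (snd p) x) * b'"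
    for p :: "'l deg" and b'
  proof (rule A.additive_eqI[of _ "\<lambda>x. f (sg (snd p) x) * b'"])
    show "additive_on UNIV (hext GA (\<lambda>r x'. signed (snd p * snd r) (f x' * b')))"
      by (rule A.hext_additive) (simp add: additive_on_def distrib_right signed_plus plus)
    fix r x assume "x \<in> GA r"
    then show "hext GA (\<lambda>r x'. signed (snd p * snd r) (f x' * b')) x = f (sg (snd p) x) * b'"
      by (subst A.hext_homog[of _ _ r])
        (simp_all add: additive_on_def distrib_right signed_plus plus sg_homog
          signed_mult_left signed_additive[OF f])
  qed (simp_all add: additive_on_def distrib_right plus sg_plus)
  then show ?thesis
    by (simp add: HOM_left_def twisted_bimodule_def ract_N)
qed

lemma ract_HL_additive:
  assumes "f \<in> internal_sum L"
  shows "additive_on B (\<lambda>b. ract HL f b x)"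
  unfolding ract_HL[OF assms] by (rule B.hext_additive) (simp add: additive_on_def distrib_left)

lemma ract_HL_homog:
  assumes "b \<in> GB p" "f \<in> internal_sum L"
  shows "ract HL f b x = f (sg (snd p) x) * b"
  unfolding ract_HL[OF assms(2)]
  by (rule B.hext_homog[OF _ assms(1)]) (simp add: additive_on_def distrib_left)

lemma carrier_HL: "carrier HL = internal_sum L" and grade_HL: "grade HL = L"
  by (simp_all add: HOM_left_def)

lemma carrier_HR: "carrier HR = internal_sum R" and grade_HR: "grade HR = R"
  by (simp_all add: HOM_right_def)

lemma lact_HR: "b \<in> B \<Longrightarrow> lact HR b f x = sg (snd S) b * f x"
  by (simp add: HOM_right_def lact_N)

lemma ract_HR: "ract HR f a x = f (\<alpha>' a * x)"
  by (simp add: HOM_right_def twisted_bimodule_def)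

section \<open>Dual bases\<close>


abbreviation AM :: "('l, 'a, 'a, 'a) bimodule" where "AM \<equiv> mult_bimodule UNIV GA"

lemma AM_simps [simp]:
  "carrier AM = UNIV" "grade AM = GA" "lact AM a x = a * x" "ract AM x a = x * a"
  by (simp_all add: mult_bimodule_def)

text \<open>The coordinate functions are strictly \<open>B\<close>-linear, although free modules are
  built from shifts whose left action carries signs; \<open>sg\<close> converts between the
  two.\<close>

definition left_dual_basis ::
    "'i set \<Rightarrow> ('i \<Rightarrow> 'l deg) \<Rightarrow> ('i \<Rightarrow> 'a \<Rightarrow> 'a) \<Rightarrow> ('i \<Rightarrow> 'a) \<Rightarrow> bool" where
  "left_dual_basis I s h x \<longleftrightarrow> finite I
     \<and> (\<forall>i\<in>I. hmap (- s i) (h i) \<and> (\<forall>b\<in>B. \<forall>a. h i (b * a) = b * h i a) \<and> x i \<in> GA (s i))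
     \<and> (\<forall>a. (\<Sum>i\<in>I. h i a * x i) = a)"

definition right_dual_basis ::
    "'i set \<Rightarrow> ('i \<Rightarrow> 'l deg) \<Rightarrow> ('i \<Rightarrow> 'a \<Rightarrow> 'a) \<Rightarrow> ('i \<Rightarrow> 'a) \<Rightarrow> bool" where
  "right_dual_basis I s h x \<longleftrightarrow> finite I
     \<and> (\<forall>i\<in>I. hmap (- s i) (h i) \<and> (\<forall>b\<in>B. \<forall>a. h i (a * b) = h i a * b) \<and> x i \<in> GA (s i))
     \<and> (\<forall>a. (\<Sum>i\<in>I. x i * h i a) = a)"

section \<open>Dual bases and direct summands of free modules\<close>

lemma carrier_free: "v \<in> carrier (free_bimodule B GB I s) \<longleftrightarrow>
    finite {i. v i \<noteq> 0} \<and> (\<forall>i\<in>I. v i \<in> B) \<and> (\<forall>i. i \<notin> I \<longrightarrow> v i = 0)"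
  by (simp add: free_bimodule_def)

lemma grade_free: "v \<in> grade (free_bimodule B GB I s) d \<longleftrightarrow>
    v \<in> carrier (free_bimodule B GB I s) \<and> (\<forall>i\<in>I. v i \<in> GB (d - s i))"
  by (simp add: free_bimodule_def grade_N)

lemma lact_free: "b \<in> B \<Longrightarrow> lact (free_bimodule B GB I s) b v i = sg (snd (s i)) b * v i"
  by (simp add: free_bimodule_def lact_N)

lemma ract_free: "ract (free_bimodule B GB I s) v b i = v i * b"
  by (simp add: free_bimodule_def ract_N)

lemma add_subgroup_free: "add_subgroup (carrier (free_bimodule B GB I s))"
  unfolding add_subgroup_def
proof (intro conjI ballI)
  fix v w assume vw: "v \<in> carrier (free_bimodule B GB I s)" "w \<in> carrier (free_bimodule B GB I s)"
  then have "finite ({i. v i \<noteq> 0} \<union> {i. w i \<noteq> 0})"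
    by (simp add: carrier_free)
  moreover have "{i. (v - w) i \<noteq> 0} \<subseteq> {i. v i \<noteq> 0} \<union> {i. w i \<noteq> 0}"
    by auto
  ultimately have "finite {i. (v - w) i \<noteq> 0}"
    by (rule rev_finite_subset)
  with vw show "v - w \<in> carrier (free_bimodule B GB I s)"
    by (auto simp: carrier_free add_subgroup_diff[OF B.subgroup])
qed (simp add: carrier_free add_subgroup_zero[OF B.subgroup])

definition unit_vec :: "'i \<Rightarrow> 'i \<Rightarrow> 'a" where
  "unit_vec i k = (if k = i then 1 else 0)"

lemma unit_vec_carrier: "i \<in> I \<Longrightarrow> unit_vec i \<in> carrier (free_bimodule B GB I s)"
  by (auto simp: carrier_free unit_vec_def B_one add_subgroup_zero[OF B.subgroup]
      intro: finite_subset[of _ "{i}"])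

lemma unit_vec_grade: "i \<in> I \<Longrightarrow> unit_vec i \<in> grade (free_bimodule B GB I s) (s i)"
  using unit_vec_carrier
  by (auto simp: grade_free unit_vec_def B_one_mem add_subgroup_zero[OF B.grade_subgroup])

text \<open>The images under \<open>j\<close> of finitely many generators involve finitely many
  coordinates, and by linearity so does all of \<open>j\<close>. The coordinates of
  \<open>j\<close>, with the images of the unit vectors under \<open>p\<close>, form the dual
  basis.\<close>

lemma left_dual_basis_exists:
  assumes "fin_gen_left B AM" "projective_left B GB AM"
  shows "\<exists>(I :: 'a set) s h x. left_dual_basis I s h x"
proof -
  obtain X where X: "finite X" "\<And>m. \<exists>c. c ` X \<subseteq> B \<and> m = (\<Sum>x\<in>X. c x * x)"
    using assms(1) by (auto simp: fin_gen_left_def)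
  obtain I :: "'a set" and s j p where j: "left_hom B AM (free_bimodule B GB I s) j"
    and p: "left_hom B (free_bimodule B GB I s) AM p" and pj: "\<And>x. p (j x) = x"
    using assms(2) by (auto simp: projective_left_def)
  let ?F = "free_bimodule B GB I s"
  have j_carrier: "j a \<in> carrier ?F" and j_add: "additive_on UNIV j"
    and j_grade: "a \<in> GA d \<Longrightarrow> j a \<in> grade ?F d"
    and j_lact: "b \<in> B \<Longrightarrow> j (b * a) = lact ?F b (j a)" for a d b
    using j by (auto simp: left_hom_def graded_hom_def)
  have p_add: "additive_on (carrier ?F) p" and p_grade: "v \<in> grade ?F d \<Longrightarrow> p v \<in> GA d"
    and p_lact: "b \<in> B \<Longrightarrow> v \<in> carrier ?F \<Longrightarrow> p (lact ?F b v) = b * p v" for v d b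
    using p by (auto simp: left_hom_def graded_hom_def)
  define J where "J = (\<Union>x\<in>X. {i. j x i \<noteq> 0})"
  have J: "finite J" "J \<subseteq> I"
    using X(1) j_carrier by (fastforce simp: J_def carrier_free)+
  have supp: "j a i = 0" if "i \<notin> J" for a i
  proof -
    obtain c where c: "c ` X \<subseteq> B" "a = (\<Sum>x\<in>X. c x * x)"
      using X(2) by blast
    then have "j a = (\<Sum>x\<in>X. lact ?F (c x) (j x))"
      by (auto simp: additive_on_sum[OF j_add add_subgroup_UNIV] j_lact intro!: sum.cong)
    then have "j a i = (\<Sum>x\<in>X. lact ?F (c x) (j x)) i"
      by (rule fun_cong)
    also have "\<dots> = 0"
      unfolding sum_fun_apply
      by (rule sum.neutral) (use c(1) that in \<open>auto simp: lact_free J_def\<close>)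
    finally show ?thesis .
  qed
  \<comment> \<open>The left action in summand \<open>i\<close> is twisted by the parity of
    \<open>s i\<close>; applying \<open>sg\<close> to the coordinate makes it strictly
    linear.\<close>
  let ?h = "\<lambda>i a. sg (snd (s i)) (j a i)"
  have j_B: "j a i \<in> B" if "i \<in> J" for i a
    using that J(2) j_carrier[of a] by (auto simp: carrier_free)
  then have h_B: "?h i a \<in> B" if "i \<in> J" for i a
    using that by (simp add: sg_B)
  have lact_carrier: "lact ?F (?h i a) (unit_vec i) \<in> carrier ?F" if "i \<in> J" for i a
    using that h_B[OF that, of a] j_B[OF that, of a] J(2)
    by (auto simp: carrier_free lact_free unit_vec_def add_subgroup_zero[OF B.subgroup]
        intro: finite_subset[of _ "{i}"])
  have expand: "j a = (\<Sum>i\<in>J. lact ?F (?h i a) (unit_vec i))" for a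
  proof
    fix k
    have "(\<Sum>i\<in>J. lact ?F (?h i a) (unit_vec i)) k = (\<Sum>i\<in>J. if i = k then j a k else 0)"
      unfolding sum_fun_apply by (rule sum.cong) (auto simp: lact_free h_B unit_vec_def)
    also have "\<dots> = j a k"
      using supp J(1) by auto
    finally show "j a k = (\<Sum>i\<in>J. lact ?F (?h i a) (unit_vec i)) k" ..
  qed
  have "(\<Sum>i\<in>J. ?h i a * p (unit_vec i)) = a" for a
  proof -
    have "p (j a) = (\<Sum>i\<in>J. p (lact ?F (?h i a) (unit_vec i)))"
      by (subst expand) (rule additive_on_sum[OF p_add add_subgroup_free lact_carrier])
    then show ?thesis
      using J(2) by (auto simp: pj p_lact h_B unit_vec_carrier subset_iff)
  qed
  moreover have "hmap (- s i) (?h i)" if "i \<in> J" for i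
    using that J(2) j_grade
    by (intro hmapI) (auto simp: additive_on_add[OF j_add] sg_plus grade_free intro!: sg_GB)
  moreover have "?h i (b * a) = b * ?h i a" if "b \<in> B" for i b a
    using that by (simp add: j_lact lact_free sg_mult)
  moreover have "p (unit_vec i) \<in> GA (s i)" if "i \<in> J" for i
    using that J(2) by (auto intro: p_grade unit_vec_grade)
  ultimately have "left_dual_basis J s ?h (\<lambda>i. p (unit_vec i))"
    using J(1) by (simp add: left_dual_basis_def)
  then show ?thesis
    by blast
qed

text \<open>The right action of a shift carries no sign, so here the coordinates of \<open>j\<close>
  serve as they are.\<close>

lemma right_dual_basis_exists:
  assumes "fin_gen_right B AM" "projective_right B GB AM"
  shows "\<exists>(I :: 'a set) s h x. right_dual_basis I s h x"
proof -
  obtain X where X: "finite X" "\<And>m. \<exists>c. c ` X \<subseteq> B \<and> m = (\<Sum>x\<in>X. x * c x)"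
    using assms(1) by (auto simp: fin_gen_right_def)
  obtain I :: "'a set" and s j p where j: "right_hom B AM (free_bimodule B GB I s) j"
    and p: "right_hom B (free_bimodule B GB I s) AM p" and pj: "\<And>x. p (j x) = x"
    using assms(2) by (auto simp: projective_right_def)
  let ?F = "free_bimodule B GB I s"
  have j_carrier: "j a \<in> carrier ?F" and j_add: "additive_on UNIV j"
    and j_grade: "a \<in> GA d \<Longrightarrow> j a \<in> grade ?F d"
    and j_ract: "b \<in> B \<Longrightarrow> j (a * b) = ract ?F (j a) b" for a d b
    using j by (auto simp: right_hom_def graded_hom_def)
  have p_add: "additive_on (carrier ?F) p" and p_grade: "v \<in> grade ?F d \<Longrightarrow> p v \<in> GA d"
    and p_ract: "b \<in> B \<Longrightarrow> v \<in> carrier ?F \<Longrightarrow> p (ract ?F v b) = p v * b" for v d b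
    using p by (auto simp: right_hom_def graded_hom_def)
  define J where "J = (\<Union>x\<in>X. {i. j x i \<noteq> 0})"
  have J: "finite J" "J \<subseteq> I"
    using X(1) j_carrier by (fastforce simp: J_def carrier_free)+
  have supp: "j a i = 0" if "i \<notin> J" for a i
  proof -
    obtain c where c: "c ` X \<subseteq> B" "a = (\<Sum>x\<in>X. x * c x)"
      using X(2) by blast
    then have "j a = (\<Sum>x\<in>X. ract ?F (j x) (c x))"
      by (auto simp: additive_on_sum[OF j_add add_subgroup_UNIV] j_ract intro!: sum.cong)
    then have "j a i = (\<Sum>x\<in>X. ract ?F (j x) (c x)) i"
      by (rule fun_cong)
    also have "\<dots> = 0"
      unfolding sum_fun_apply
      by (rule sum.neutral) (use that in \<open>auto simp: ract_free J_def\<close>)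
    finally show ?thesis .
  qed
  let ?h = "\<lambda>i a. j a i"
  have h_B: "?h i a \<in> B" if "i \<in> J" for i a
    using that J(2) j_carrier[of a] by (auto simp: carrier_free)
  have ract_carrier: "ract ?F (unit_vec i) (?h i a) \<in> carrier ?F" if "i \<in> J" for i a
    using that h_B[OF that, of a] J(2)
    by (auto simp: carrier_free ract_free unit_vec_def add_subgroup_zero[OF B.subgroup]
        intro: finite_subset[of _ "{i}"])
  have expand: "j a = (\<Sum>i\<in>J. ract ?F (unit_vec i) (?h i a))" for a
  proof
    fix k
    have "(\<Sum>i\<in>J. ract ?F (unit_vec i) (?h i a)) k = (\<Sum>i\<in>J. if i = k then j a k else 0)"
      unfolding sum_fun_apply by (rule sum.cong) (auto simp: ract_free unit_vec_def)
    also have "\<dots> = j a k"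
      using supp J(1) by auto
    finally show "j a k = (\<Sum>i\<in>J. ract ?F (unit_vec i) (?h i a)) k" ..
  qed
  have "(\<Sum>i\<in>J. p (unit_vec i) * ?h i a) = a" for a
  proof -
    have "p (j a) = (\<Sum>i\<in>J. p (ract ?F (unit_vec i) (?h i a)))"
      by (subst expand) (rule additive_on_sum[OF p_add add_subgroup_free ract_carrier])
    then show ?thesis
      using J(2) by (auto simp: pj p_ract h_B unit_vec_carrier subset_iff)
  qed
  moreover have "hmap (- s i) (?h i)" if "i \<in> J" for i
    using that J(2) j_grade
    by (intro hmapI) (auto simp: additive_on_add[OF j_add] grade_free)
  moreover have "?h i (a * b) = ?h i a * b" if "b \<in> B" for i b a
    using that by (simp add: j_ract ract_free)
  moreover have "p (unit_vec i) \<in> GA (s i)" if "i \<in> J" for i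
    using that J(2) by (auto intro: p_grade unit_vec_grade)
  ultimately have "right_dual_basis J s ?h (\<lambda>i. p (unit_vec i))"
    using J(1) by (simp add: right_dual_basis_def)
  then show ?thesis
    by blast
qed

text \<open>A dual basis splits the map from the free module on \<open>I\<close> onto
  \<open>A\<close>: the coordinates give the section, the elements \<open>x i\<close> the
  projection.\<close>

lemma left_dual_basisD:
  fixes I :: "'a set"
  assumes "left_dual_basis I s h x"
  shows "fin_gen_left B AM" "projective_left B GB AM"
proof -
  have fin: "finite I" and h: "\<And>i. i \<in> I \<Longrightarrow> hmap (- s i) (h i)"
    and lin: "\<And>i b a. i \<in> I \<Longrightarrow> b \<in> B \<Longrightarrow> h i (b * a) = b * h i a"
    and x: "\<And>i. i \<in> I \<Longrightarrow> x i \<in> GA (s i)" and expand: "\<And>a. (\<Sum>i\<in>I. h i a * x i) = a"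
    using assms by (auto simp: left_dual_basis_def)
  show "fin_gen_left B AM"
    unfolding fin_gen_left_def
  proof (intro exI conjI ballI)
    fix m
    \<comment> \<open>Generators form a set while \<open>x\<close> may repeat values, so
      coefficients belonging to the same generator are added up.\<close>
    let ?c = "\<lambda>y. \<Sum>i | i \<in> I \<and> x i = y. h i m"
    show "?c ` (x ` I) \<subseteq> B"
      by (auto intro!: add_subgroup_sum[OF B.subgroup] hmap_B[OF h])
    have "m = (\<Sum>y\<in>x ` I. \<Sum>i | i \<in> I \<and> x i = y. h i m * x i)"
      using expand[of m] sum.image_gen[OF fin, of "\<lambda>i. h i m * x i" x] by simp
    also have "\<dots> = (\<Sum>y\<in>x ` I. lact AM (?c y) y)"
      by (simp add: sum_distrib_right)
    finally show "m = (\<Sum>y\<in>x ` I. lact AM (?c y) y)" .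
  qed (use fin in auto)
  let ?F = "free_bimodule B GB I s"
  \<comment> \<open>\<open>sg\<close> puts the sign of the shifted left action into the coordinates;
    \<open>?p\<close> takes it out again.\<close>
  let ?j = "\<lambda>a i. if i \<in> I then sg (snd (s i)) (h i a) else 0"
  let ?p = "\<lambda>v. \<Sum>i\<in>I. sg (snd (s i)) (v i) * x i"
  have j_carrier: "?j a \<in> carrier ?F" for a
    using hmap_B[OF h] fin by (auto simp: carrier_free sg_B)
  have "left_hom B AM ?F ?j"
    using j_carrier h hmap_mem[OF h _ refl] lin hmap_plus[OF h]
    by (auto simp: left_hom_def graded_hom_def additive_on_def grade_free lact_free fun_eq_iff
        sg_plus sg_mult intro!: sg_GB)
  moreover have "left_hom B ?F AM ?p"
  proof -
    have "?p v \<in> GA d" if v: "v \<in> grade ?F d" for v d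
    proof (rule add_subgroup_sum[OF A.grade_subgroup])
      fix i assume i: "i \<in> I"
      then have "v i \<in> GB (d - s i)"
        using v by (simp add: grade_free)
      then show "sg (snd (s i)) (v i) * x i \<in> GA d"
        using mult_mem[OF sg_mem x[OF i], of "v i" "d - s i"] by (simp add: GB_iff)
    qed
    then show ?thesis
      by (auto simp: left_hom_def graded_hom_def additive_on_def lact_free sg_plus sg_mult
          distrib_right sum.distrib sum_distrib_left mult.assoc)
  qed
  moreover have "?p (?j a) = a" for a
    by (simp add: expand)
  ultimately show "projective_left B GB AM"
    unfolding projective_left_def by blast
qed

lemma right_dual_basisD:
  fixes I :: "'a set"
  assumes "right_dual_basis I s h x"
  shows "fin_gen_right B AM" "projective_right B GB AM"
proof -
  have fin: "finite I" and h: "\<And>i. i \<in> I \<Longrightarrow> hmap (- s i) (h i)"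
    and lin: "\<And>i b a. i \<in> I \<Longrightarrow> b \<in> B \<Longrightarrow> h i (a * b) = h i a * b"
    and x: "\<And>i. i \<in> I \<Longrightarrow> x i \<in> GA (s i)" and expand: "\<And>a. (\<Sum>i\<in>I. x i * h i a) = a"
    using assms by (auto simp: right_dual_basis_def)
  show "fin_gen_right B AM"
    unfolding fin_gen_right_def
  proof (intro exI conjI ballI)
    fix m
    let ?c = "\<lambda>y. \<Sum>i | i \<in> I \<and> x i = y. h i m"
    show "?c ` (x ` I) \<subseteq> B"
      by (auto intro!: add_subgroup_sum[OF B.subgroup] hmap_B[OF h])
    have "m = (\<Sum>y\<in>x ` I. \<Sum>i | i \<in> I \<and> x i = y. x i * h i m)"
      using expand[of m] sum.image_gen[OF fin, of "\<lambda>i. x i * h i m" x] by simp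
    also have "\<dots> = (\<Sum>y\<in>x ` I. ract AM y (?c y))"
      by (simp add: sum_distrib_left)
    finally show "m = (\<Sum>y\<in>x ` I. ract AM y (?c y))" .
  qed (use fin in auto)
  let ?F = "free_bimodule B GB I s"
  let ?j = "\<lambda>a i. if i \<in> I then h i a else 0"
  let ?p = "\<lambda>v. \<Sum>i\<in>I. x i * v i"
  have j_carrier: "?j a \<in> carrier ?F" for a
    using hmap_B[OF h] fin by (auto simp: carrier_free)
  have "right_hom B AM ?F ?j"
    using j_carrier h hmap_mem[OF h _ refl] lin hmap_plus[OF h]
    by (auto simp: right_hom_def graded_hom_def additive_on_def grade_free ract_free fun_eq_iff)
  moreover have "right_hom B ?F AM ?p"
  proof -
    have "?p v \<in> GA d" if v: "v \<in> grade ?F d" for v d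
    proof (rule add_subgroup_sum[OF A.grade_subgroup])
      fix i assume i: "i \<in> I"
      then have "v i \<in> GB (d - s i)"
        using v by (simp add: grade_free)
      then show "x i * v i \<in> GA d"
        using mult_mem[OF x[OF i], of "v i" "d - s i"] by (simp add: GB_iff)
    qed
    then show ?thesis
      by (auto simp: right_hom_def graded_hom_def additive_on_def ract_free
          distrib_left sum.distrib sum_distrib_right mult.assoc)
  qed
  moreover have "?p (?j a) = a" for a
    by (simp add: expand)
  ultimately show "projective_right B GB AM"
    unfolding projective_right_def by blast
qed

section \<open>Frobenius systems\<close>


definition \<theta> :: "'a \<Rightarrow> 'a" where "\<theta> b = \<beta> (sg (snd S) b)"

lemma sg_cancel: "sg (\<gamma> + \<delta>) (sg \<gamma> x) = sg \<delta> x"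
  using sg_sg[of \<delta> \<gamma> "sg \<gamma> x"] by (simp add: add.commute)

lemma \<theta>_plus: "x \<in> B \<Longrightarrow> y \<in> B \<Longrightarrow> \<theta> (x + y) = \<theta> x + \<theta> y"
  by (simp add: \<theta>_def sg_plus \<beta>_plus sg_B)

lemma \<theta>_mem: "b \<in> GB d \<Longrightarrow> \<theta> b \<in> GB d"
  by (simp add: \<theta>_def \<beta>_mem sg_GB)

text \<open>The first two clauses say that \<open>\<tau>\<close> lies in \<open>L 0\<close>; the
  third is compatibility with the right action of \<open>B\<close> twisted by
  \<open>\<alpha>\<close>.\<close>

definition trace_map :: "('a \<Rightarrow> 'a) \<Rightarrow> bool" where
  "trace_map \<tau> \<longleftrightarrow> hmap (- S) \<tau> \<and> (\<forall>b\<in>B. \<forall>x. \<tau> (\<beta> b * x) = sg (snd S) b * \<tau> x)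
     \<and> (\<forall>b\<in>B. \<forall>x. \<tau> (x * \<alpha> b) = \<tau> x * b)"

text \<open>The \<open>sg\<close> in \<open>\<theta>\<close> cancels the one in the hypothesis. The
  map \<open>h\<close> is arbitrary because the rule also serves for the maps that are to be
  represented by \<open>\<tau>\<close>.\<close>

lemma \<theta>_pull:
  assumes "\<And>b x. b \<in> B \<Longrightarrow> h (\<beta> b * x) = sg (snd S) b * h x" "b \<in> B"
  shows "h (\<theta> b * x) = b * h x"
  by (simp add: \<theta>_def assms sg_B)

text \<open>The degrees fit: for \<open>a\<close> of degree \<open>d\<close>,
  \<open>\<tau> (a * y i)\<close> has degree \<open>d - s i\<close>, as a coordinate along
  \<open>x i\<close> must.\<close>

definition frobenius_system ::
    "('a \<Rightarrow> 'a) \<Rightarrow> 'i set \<Rightarrow> ('i \<Rightarrow> 'l deg) \<Rightarrow> ('i \<Rightarrow> 'a) \<Rightarrow> ('i \<Rightarrow> 'a) \<Rightarrow> bool" where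
  "frobenius_system \<tau> I s x y \<longleftrightarrow> trace_map \<tau> \<and> finite I
     \<and> (\<forall>i\<in>I. x i \<in> GA (s i) \<and> y i \<in> GA (S - s i))
     \<and> (\<forall>a. (\<Sum>i\<in>I. \<theta> (\<tau> (a * y i)) * x i) = a)
     \<and> (\<forall>a. (\<Sum>i\<in>I. y i * \<alpha> (\<tau> (x i * a))) = a)"

section \<open>From the symmetric datum to both sets of conditions\<close>

context
  fixes \<tau> I s x y
  assumes frob: "frobenius_system \<tau> I s x y"
begin

lemma \<tau>: "hmap (- S) \<tau>"
  and \<tau>_left: "b \<in> B \<Longrightarrow> \<tau> (\<beta> b * z) = sg (snd S) b * \<tau> z"
  and \<tau>_right: "b \<in> B \<Longrightarrow> \<tau> (z * \<alpha> b) = \<tau> z * b"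
  and fin: "finite I"
  and x: "i \<in> I \<Longrightarrow> x i \<in> GA (s i)" and y: "i \<in> I \<Longrightarrow> y i \<in> GA (S - s i)"
  and left_expand: "(\<Sum>i\<in>I. \<theta> (\<tau> (a * y i)) * x i) = a"
  and right_expand: "(\<Sum>i\<in>I. y i * \<alpha> (\<tau> (x i * a))) = a"
  using frob by (simp_all add: frobenius_system_def trace_map_def)

lemma \<tau>_\<theta>: "b \<in> B \<Longrightarrow> \<tau> (\<theta> b * z) = b * \<tau> z"
  by (rule \<theta>_pull[OF \<tau>_left])

lemma left_dual_basis_frob: "left_dual_basis I s (\<lambda>i a. \<theta> (\<tau> (a * y i))) x"
proof -
  have "hmap (- s i) (\<lambda>a. \<theta> (\<tau> (a * y i)))" if i: "i \<in> I" for i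
    by (rule hmapI) (auto simp: distrib_right hmap_plus[OF \<tau>] \<theta>_plus hmap_B[OF \<tau>]
        intro!: \<theta>_mem hmap_mem[OF \<tau> mult_mem[OF _ y[OF i]]])
  \<comment> \<open>Write \<open>b\<close> as \<open>\<beta> (\<beta>' b)\<close>: pulling it out of
    \<open>\<tau>\<close> leaves \<open>\<beta>' b\<close> with a sign, which
    \<open>\<theta>\<close> turns back into \<open>b\<close>.\<close>
  moreover have "\<theta> (\<tau> (b * a * y i)) = b * \<theta> (\<tau> (a * y i))" if b: "b \<in> B" for b a i
    using b \<tau>_left[of "\<beta>' b" "a * y i"]
    by (simp add: \<theta>_def mult.assoc sg_mult \<beta>_mult sg_B hmap_B[OF \<tau>] \<beta>'_B)
  ultimately show ?thesis
    by (simp add: left_dual_basis_def fin x left_expand)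
qed

text \<open>Applying \<open>\<alpha>'\<close> to the second expansion at \<open>\<alpha> a\<close>
  frees the coefficients from \<open>\<alpha>\<close>. The basis elements now come from the
  \<open>y i\<close>, whence the degrees \<open>S - s i\<close>.\<close>

lemma right_dual_basis_frob:
  "right_dual_basis I (\<lambda>i. S - s i) (\<lambda>i a. \<tau> (x i * \<alpha> a)) (\<lambda>i. \<alpha>' (y i))"
proof -
  have "hmap (- (S - s i)) (\<lambda>a. \<tau> (x i * \<alpha> a))" if i: "i \<in> I" for i
    by (rule hmapI) (auto simp: distrib_left hmap_plus[OF \<tau>] \<alpha>_plus
        intro!: hmap_mem[OF \<tau> mult_mem[OF x[OF i] \<alpha>_mem]])
  moreover have "\<tau> (x i * \<alpha> (a * b)) = \<tau> (x i * \<alpha> a) * b" if "b \<in> B" for b a i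
    using that by (simp add: \<alpha>_mult mult.assoc[symmetric] \<tau>_right)
  moreover have "(\<Sum>i\<in>I. \<alpha>' (y i) * \<tau> (x i * \<alpha> a)) = a" for a
    using arg_cong[OF right_expand[of "\<alpha> a"], of \<alpha>'] by (simp add: \<alpha>'_sum \<alpha>'_mult)
  ultimately show ?thesis
    by (simp add: right_dual_basis_def fin \<alpha>'_mem y)
qed

lemma left_iso_frob: "bimodule_iso UNIV B AM HL"
proof -
  \<comment> \<open>This is the left multiple of \<open>\<tau>\<close> by \<open>a\<close> in
    \<open>HL\<close>, forced by left linearity once 1 goes to \<open>\<tau>\<close>. The sign
    depends on the parity of \<open>a\<close>, so the formula is extended from homogeneous
    \<open>a\<close>.\<close>
  let ?F = "\<lambda>x p a. \<tau> (sg (snd p) x * \<alpha> a)"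
  define \<phi> where "\<phi> a x = hext GA (?F x) a" for a x
  have F_add: "additive_on (GA p) (?F x p)" for x p
    by (simp add: additive_on_def \<alpha>_plus distrib_left hmap_plus[OF \<tau>])
  have \<phi>_homog: "\<phi> a x = \<tau> (sg (snd p) x * \<alpha> a)" if "a \<in> GA p" for a p x
    unfolding \<phi>_def by (rule A.hext_homog[OF F_add that])
  have \<phi>_add: "additive_on UNIV \<phi>"
    using A.hext_additive[OF F_add] by (simp add: \<phi>_def additive_on_def fun_eq_iff)
  have \<phi>_mem: "\<phi> a \<in> L p" if a: "a \<in> GA p" for a p
  proof -
    have "hmap (p - S) (\<phi> a)"
      by (rule hmapI) (auto simp: \<phi>_homog[OF a] distrib_right hmap_plus[OF \<tau>] sg_plus
          intro!: hmap_mem[OF \<tau> mult_mem[OF sg_mem \<alpha>_mem[OF a]]])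
    then show ?thesis
      by (simp add: L_iff \<phi>_homog[OF a] sg_mult \<beta>_sg[symmetric] mult.assoc \<tau>_left sg_B sg_sg
          add.commute)
  qed
  have \<phi>_image: "\<phi> ` GA d \<subseteq> L d" for d
    using \<phi>_mem by blast
  have \<phi>_carrier: "\<phi> a \<in> internal_sum L" for a
    using AL.graded_additive_mem[OF \<phi>_add \<phi>_image] by simp
  have lact: "\<phi> (a * a') x = lact HL a (\<phi> a') x" for a a' x
  proof (rule A.additive_eqI[of "\<lambda>a. \<phi> (a * a') x" "\<lambda>a. lact HL a (\<phi> a') x"])
    fix p a assume a: "a \<in> GA p"
    show "\<phi> (a * a') x = lact HL a (\<phi> a') x"
    proof (rule A.additive_eqI[of "\<lambda>a'. \<phi> (a * a') x" "\<lambda>a'. lact HL a (\<phi> a') x"])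
      fix q a' assume a': "a' \<in> GA q"
      \<comment> \<open>The sign of the action, with exponent \<open>snd p * snd q\<close>, cancels
        the one that \<open>sg (snd q)\<close> produces on \<open>\<alpha> a\<close>.\<close>
      show "\<phi> (a * a') x = lact HL a (\<phi> a') x"
        unfolding lact_HL_homog[OF a \<phi>_mem[OF a']]
        unfolding \<phi>_homog[OF mult_mem[OF a a']] \<phi>_homog[OF a']
        using \<alpha>_mem[OF a]
        by (simp add: sg_mult sg_sg sg_homog[of _ p] signed_mult_left signed_mult_right
            hmap_signed[OF \<tau>] \<alpha>_mult mult.assoc mult.commute[of "snd q"] add.commute[of "snd q"])
    qed (simp_all add: additive_on_def distrib_left additive_on_add[OF \<phi>_add]
        additive_on_add[OF lact_HL_additive_right] \<phi>_carrier)
  qed (use \<phi>_add lact_HL_additive_left[OF \<phi>_carrier] in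
      \<open>auto simp: additive_on_def distrib_right fun_eq_iff\<close>)
  have ract: "\<phi> (a * b) x = ract HL (\<phi> a) b x" if b: "b \<in> B" for a b x
  proof (rule B.additive_eqI[OF _ _ _ b])
    fix p b assume b: "b \<in> GB p"
    show "\<phi> (a * b) x = ract HL (\<phi> a) b x"
      unfolding ract_HL_homog[OF b \<phi>_carrier]
    proof (rule A.additive_eqI[of "\<lambda>a. \<phi> (a * b) x" "\<lambda>a. \<phi> a (sg (snd p) x) * b"])
      fix q a assume a: "a \<in> GA q"
      show "\<phi> (a * b) x = \<phi> a (sg (snd p) x) * b"
        using b \<phi>_homog[OF mult_mem[OF a, of b p]] \<phi>_homog[OF a]
        by (simp add: GB_iff \<alpha>_mult mult.assoc[symmetric] \<tau>_right sg_sg)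
    qed (use \<phi>_add in \<open>auto simp: additive_on_def distrib_right fun_eq_iff\<close>)
  qed (use \<phi>_add ract_HL_additive[OF \<phi>_carrier] in
      \<open>auto simp: additive_on_def distrib_left fun_eq_iff\<close>)
  have "bij_betw \<phi> UNIV (internal_sum L)"
  proof (rule AL.graded_bijI[OF \<phi>_add \<phi>_image])
    fix p a assume a: "a \<in> GA p" and "\<phi> a = 0"
    then have zero: "\<tau> (sg (snd p) z * \<alpha> a) = 0" for z
      by (simp add: \<phi>_homog fun_eq_iff)
    \<comment> \<open>With \<open>z\<close> the sign twist of \<open>x i\<close>,
      \<open>zero\<close> kills each coefficient of \<open>\<alpha> a\<close> in the second
      expansion.\<close>
    have "\<alpha> a = 0"
      using right_expand[of "\<alpha> a"] zero[of "sg (snd p) (x _)"] by simp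
    then show "a = 0"
      by (metis \<alpha>_zero inv_\<alpha>)
  next
    fix e g assume g: "g \<in> L e"
    \<comment> \<open>The sign twist cancels the part of the sign due to the degree of
      \<open>g\<close>, so \<open>?h\<close> has the same left linearity as
      \<open>\<tau>\<close>.\<close>
    let ?h = "\<lambda>z. g (sg (snd e) z)"
    have g_map: "hmap (e - S) g" and g_left: "b \<in> B \<Longrightarrow> g (\<beta> b * z) = sg (snd e + snd S) b * g z"
      for b z using g by (auto simp: L_iff)
    have h_left: "?h (\<beta> b * z) = sg (snd S) b * ?h z" if "b \<in> B" for b z
      using that g_left[of "sg (snd e) b" "sg (snd e) z"]
      by (simp add: sg_mult \<beta>_sg sg_B sg_cancel)
    have h_plus: "?h (\<Sum>i\<in>I. f i) = (\<Sum>i\<in>I. ?h (f i))" for f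
      by (simp add: sg_sum hmap_sum[OF g_map])
    \<comment> \<open>Found by evaluating \<open>?h\<close> on the first expansion of
      \<open>z\<close>: the coefficients \<open>\<tau> (z * y i)\<close> come out on the left, and
      the values \<open>?h (x i)\<close> then enter \<open>\<tau>\<close> on the right through
      \<open>\<alpha>\<close>.\<close>
    define c where "c = (\<Sum>i\<in>I. y i * \<alpha> (?h (x i)))"
    have c: "c \<in> GA e"
      unfolding c_def
    proof (rule add_subgroup_sum[OF A.grade_subgroup])
      fix i assume i: "i \<in> I"
      have "\<alpha> (?h (x i)) \<in> GA (s i + (e - S))"
        using hmap_mem[OF g_map sg_mem[OF x[OF i]] refl] by (simp add: \<alpha>_mem GB_iff)
      from mult_mem[OF y[OF i] this] show "y i * \<alpha> (?h (x i)) \<in> GA e"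
        by simp
    qed
    have h: "?h z = \<tau> (z * c)" for z
    proof -
      have "?h z = ?h (\<Sum>i\<in>I. \<theta> (\<tau> (z * y i)) * x i)"
        by (simp add: left_expand)
      also have "\<dots> = (\<Sum>i\<in>I. \<tau> (z * y i) * ?h (x i))"
        unfolding h_plus using \<theta>_pull[OF h_left hmap_B[OF \<tau>]] by simp
      also have "\<dots> = \<tau> (z * c)"
        by (simp add: c_def sum_distrib_left hmap_sum[OF \<tau>] mult.assoc[symmetric]
            \<tau>_right hmap_B[OF g_map])
      finally show ?thesis .
    qed
    show "\<exists>a\<in>GA e. \<phi> a = g"
    proof (rule bexI[OF _ \<alpha>'_mem[OF c]])
      show "\<phi> (\<alpha>' c) = g"
        by (simp add: fun_eq_iff \<phi>_homog[OF \<alpha>'_mem[OF c]] h[symmetric])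
    qed
  qed
  moreover have "left_hom UNIV AM HL \<phi>"
    using \<phi>_carrier \<phi>_add \<phi>_mem lact
    by (auto simp: left_hom_def graded_hom_def carrier_HL grade_HL fun_eq_iff)
  moreover have "right_hom B AM HL \<phi>"
    using \<phi>_carrier \<phi>_add \<phi>_mem ract
    by (auto simp: right_hom_def graded_hom_def carrier_HL grade_HL fun_eq_iff)
  ultimately show ?thesis
    unfolding bimodule_iso_def carrier_HL by (intro exI[of _ \<phi>]) simp
qed

lemma right_iso_frob: "bimodule_iso B UNIV AM HR"
proof -
  \<comment> \<open>Right linearity, with 1 sent to the conjugate
    \<open>\<beta> \<circ> \<tau> \<circ> \<alpha>\<close>, forces this formula. The right action
    carries no sign, so one formula serves all \<open>a\<close>.\<close>
  let ?\<psi> = "\<lambda>a z. \<beta> (\<tau> (a * \<alpha> z))"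
  have \<psi>_add: "additive_on UNIV ?\<psi>"
    by (simp add: additive_on_def fun_eq_iff distrib_right hmap_plus[OF \<tau>] \<beta>_plus hmap_B[OF \<tau>])
  have \<psi>_mem: "?\<psi> a \<in> R p" if a: "a \<in> GA p" for a p
  proof -
    have "hmap (p - S) (?\<psi> a)"
      by (rule hmapI) (auto simp: distrib_left \<alpha>_plus hmap_plus[OF \<tau>] \<beta>_plus hmap_B[OF \<tau>]
          intro!: \<beta>_mem hmap_mem[OF \<tau> mult_mem[OF a \<alpha>_mem]])
    then show ?thesis
      by (simp add: R_iff \<alpha>_mult mult.assoc[symmetric] \<tau>_right \<beta>'_B \<beta>_mult hmap_B[OF \<tau>])
  qed
  have \<psi>_image: "?\<psi> ` GA d \<subseteq> R d" for d
    using \<psi>_mem by blast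
  have \<psi>_carrier: "?\<psi> a \<in> internal_sum R" for a
    using AR.graded_additive_mem[OF \<psi>_add \<psi>_image] by simp
  have lact: "?\<psi> (b * a) z = lact HR b (?\<psi> a) z" if b: "b \<in> B" for a b z
    using b \<tau>_left[of "\<beta>' b" "a * \<alpha> z"]
    by (simp add: lact_HR mult.assoc \<beta>'_B \<beta>_mult sg_B hmap_B[OF \<tau>] \<beta>_sg)
  have ract: "?\<psi> (a * c) z = ract HR (?\<psi> a) c z" for a c z
    by (simp add: ract_HR \<alpha>_mult mult.assoc)
  have "bij_betw ?\<psi> UNIV (internal_sum R)"
  proof (rule AR.graded_bijI[OF \<psi>_add \<psi>_image])
    fix p a assume zero: "?\<psi> a = 0"
    have "\<beta> (\<tau> (a * z)) = 0" for z
      using fun_cong[OF zero, of "\<alpha>' z"] by simp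
    \<comment> \<open>\<open>\<beta>\<close> is injective on \<open>B\<close>, where
      \<open>\<tau>\<close> takes its values; hence all coefficients of \<open>a\<close> in the
      first expansion vanish.\<close>
    then have "\<tau> (a * z) = 0" for z
      using inj_onD[OF bij_betw_imp_inj_on[OF \<beta>_bij], of "\<tau> (a * z)" 0]
        additive_on_zero[OF \<beta>_additive] add_subgroup_zero[OF B.subgroup] hmap_B[OF \<tau>]
      by simp
    then show "a = 0"
      using left_expand[of a] by (simp add: \<theta>_def additive_on_zero[OF \<beta>_additive]
          add_subgroup_zero[OF B.subgroup])
  next
    fix e g assume g: "g \<in> R e"
    \<comment> \<open>Undoing \<open>\<beta>\<close> and \<open>\<alpha>\<close> gives a map with
      the right linearity of \<open>\<tau>\<close>.\<close>
    let ?h = "\<lambda>z. \<beta>' (g (\<alpha>' z))"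
    have g_map: "hmap (e - S) g" and g_right: "b \<in> B \<Longrightarrow> g (z * \<beta>' b) = g z * b"
      for b z using g by (auto simp: R_iff)
    have h_map: "hmap (e - S) ?h"
      by (rule hmapI) (auto simp: \<alpha>'_plus hmap_plus[OF g_map] \<beta>'_plus hmap_B[OF g_map]
          intro!: \<beta>'_mem hmap_mem[OF g_map \<alpha>'_mem])
    have h_right: "?h (z * \<alpha> b) = ?h z * b" if "b \<in> B" for b z
      using that g_right[of "\<beta> b" "\<alpha>' z"]
      by (simp add: \<alpha>'_mult \<beta>'_mult \<beta>_B hmap_B[OF g_map])
    \<comment> \<open>Evaluating \<open>?h\<close> on the second expansion of \<open>z\<close> gives
      terms \<open>?h (y i) * \<tau> (x i * z)\<close>, whose left factor enters
      \<open>\<tau>\<close> as \<open>\<theta> (?h (y i))\<close>.\<close>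
    define c where "c = (\<Sum>i\<in>I. \<theta> (?h (y i)) * x i)"
    have c: "c \<in> GA e"
      unfolding c_def
    proof (rule add_subgroup_sum[OF A.grade_subgroup])
      fix i assume i: "i \<in> I"
      have "\<theta> (?h (y i)) \<in> GA (S - s i + (e - S))"
        using \<theta>_mem[OF hmap_mem[OF h_map y[OF i] refl]] by (simp only: GB_iff)
      from mult_mem[OF this x[OF i]] show "\<theta> (?h (y i)) * x i \<in> GA e"
        by simp
    qed
    have h: "?h z = \<tau> (c * z)" for z
    proof -
      have "?h z = ?h (\<Sum>i\<in>I. y i * \<alpha> (\<tau> (x i * z)))"
        by (simp add: right_expand)
      also have "\<dots> = (\<Sum>i\<in>I. ?h (y i) * \<tau> (x i * z))"
        unfolding hmap_sum[OF h_map] by (simp add: h_right hmap_B[OF \<tau>])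
      also have "\<dots> = \<tau> (c * z)"
        by (simp add: c_def sum_distrib_right hmap_sum[OF \<tau>] mult.assoc \<tau>_\<theta> hmap_B[OF h_map])
      finally show ?thesis .
    qed
    show "\<exists>a\<in>GA e. ?\<psi> a = g"
      by (rule bexI[OF _ c]) (simp add: fun_eq_iff h[symmetric] hmap_B[OF g_map])
  qed
  moreover have "left_hom B AM HR ?\<psi>"
    using \<psi>_carrier \<psi>_add \<psi>_mem lact
    by (auto simp: left_hom_def graded_hom_def carrier_HR grade_HR fun_eq_iff)
  moreover have "right_hom UNIV AM HR ?\<psi>"
    using \<psi>_carrier \<psi>_add \<psi>_mem ract
    by (auto simp: right_hom_def graded_hom_def carrier_HR grade_HR fun_eq_iff)
  ultimately show ?thesis
    unfolding bimodule_iso_def carrier_HR by (intro exI[of _ ?\<psi>]) simp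
qed

end

section \<open>Nondegenerate traces from bimodule isomorphisms\<close>

text \<open>The trace map is the image of 1 under the isomorphism.\<close>

lemma left_iso_trace:
  assumes "bimodule_iso UNIV B AM HL"
  obtains \<tau> where "trace_map \<tau>"
    and "\<And>p a. a \<in> GA p \<Longrightarrow> (\<And>z. \<tau> (z * a) = 0) \<Longrightarrow> a = 0"
    and "\<And>k h. hmap k h \<Longrightarrow> (\<And>b z. b \<in> B \<Longrightarrow> h (\<beta> b * z) = sg (snd S) b * h z) \<Longrightarrow>
      \<exists>y\<in>GA (k + S). \<forall>z. h z = \<tau> (z * y)"
proof -
  obtain \<phi> where \<phi>: "left_hom UNIV AM HL \<phi>" "right_hom B AM HL \<phi>"
      "bij_betw \<phi> UNIV (internal_sum L)"
    using assms by (auto simp: bimodule_iso_def carrier_HL)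
  have \<phi>_add: "additive_on UNIV \<phi>" and \<phi>_image: "\<phi> ` GA d \<subseteq> L d"
    and \<phi>_lact: "\<phi> (a * a') = lact HL a (\<phi> a')"
    and \<phi>_ract: "b \<in> B \<Longrightarrow> \<phi> (a * b) = ract HL (\<phi> a) b" for d a a' b
    using \<phi>(1,2) by (simp_all add: left_hom_def right_hom_def graded_hom_def grade_HL)
  have \<phi>_mem: "\<phi> a \<in> L p" if "a \<in> GA p" for a p
    using \<phi>_image that by blast
  define \<tau> where "\<tau> = \<phi> 1"
  have \<tau>_mem: "\<tau> \<in> L 0"
    unfolding \<tau>_def by (rule \<phi>_mem[OF one_mem])
  \<comment> \<open>Left linearity at \<open>a * 1\<close> makes \<open>\<phi> a\<close> the left
    multiple of \<open>\<tau>\<close> by \<open>a\<close>; \<open>\<tau>\<close> has degree 0 in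
    \<open>HL\<close> and adds no sign.\<close>
  have \<phi>_homog: "\<phi> a z = \<tau> (sg (snd p) z * \<alpha> a)" if "a \<in> GA p" for a p z
    using \<phi>_lact[of a 1] lact_HL_homog[OF that \<tau>_mem, of z] by (simp add: \<tau>_def)
  have \<tau>: "hmap (- S) \<tau>" and \<tau>_left: "\<forall>b\<in>B. \<forall>z. \<tau> (\<beta> b * z) = sg (snd S) b * \<tau> z"
    using \<tau>_mem by (auto simp: L_iff)
  \<comment> \<open>For homogeneous \<open>b\<close>, \<open>\<phi> b\<close> is computed twice:
    from \<open>b * 1\<close> by the left action and from \<open>1 * b\<close> by the right one.
    Evaluation at the sign twist of \<open>z\<close> removes \<open>sg\<close>.\<close>
  have "\<tau> (z * \<alpha> b) = \<tau> z * b" if b: "b \<in> B" for b z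
  proof (rule B.additive_eqI[OF _ _ _ b])
    fix p b assume b: "b \<in> GB p"
    have "\<phi> b (sg (snd p) z) = \<tau> (sg (snd p) (sg (snd p) z)) * b"
      using \<phi>_ract[of b 1] ract_HL_homog[OF b L.grade_mem[OF \<tau>_mem], of "sg (snd p) z"]
        B.grade_mem[OF b] by (simp add: \<tau>_def)
    then show "\<tau> (z * \<alpha> b) = \<tau> z * b"
      using \<phi>_homog[of b p "sg (snd p) z"] b by (simp add: GB_iff)
  qed (auto simp: additive_on_def \<alpha>_plus distrib_left hmap_plus[OF \<tau>])
  then have trace: "trace_map \<tau>"
    using \<tau> \<tau>_left by (simp add: trace_map_def)
  show thesis
  proof (rule that[OF trace])
    fix p a assume a: "a \<in> GA p" and zero: "\<And>z. \<tau> (z * a) = 0"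
    have "\<phi> (\<alpha>' a) = \<phi> 0"
      using \<phi>_homog[OF \<alpha>'_mem[OF a]] zero additive_on_zero[OF \<phi>_add] by (simp add: fun_eq_iff)
    then have "\<alpha>' a = 0"
      using \<phi>(3) by (auto simp: bij_betw_def dest: injD)
    then show "a = 0"
      by (metis \<alpha>_inv \<alpha>_zero)
  next
    fix k h assume h: "hmap k h"
      and h_left: "\<And>b z. b \<in> B \<Longrightarrow> h (\<beta> b * z) = sg (snd S) b * h z"
    let ?e = "k + S"
    \<comment> \<open>The twist supplies the sign that a map of degree \<open>?e\<close> in
      \<open>HL\<close> must have, so \<open>?g\<close> has a preimage under
      \<open>\<phi>\<close>.\<close>
    let ?g = "\<lambda>z. h (sg (snd ?e) z)"
    have "hmap (?e - S) ?g"
      by (rule hmapI) (auto simp: sg_plus hmap_plus[OF h] intro!: hmap_mem[OF h sg_mem])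
    moreover have "?g (\<beta> b * z) = sg (snd ?e + snd S) b * ?g z" if "b \<in> B" for b z
      using that h_left[of "sg (snd ?e) b" "sg (snd ?e) z"]
      by (simp add: sg_mult \<beta>_sg sg_B sg_sg add.commute[of "snd S"] del: snd_add)
    ultimately have g: "?g \<in> L ?e"
      by (simp add: L_iff)
    then obtain a where a: "\<phi> a = ?g"
      using \<phi>(3) L.grade_mem[OF g] by (metis bij_betw_imp_surj_on image_iff)
    have "a \<in> GA ?e"
      by (rule AL.graded_bij_reflects[OF \<phi>_add \<phi>_image bij_betw_imp_inj_on[OF \<phi>(3)]])
        (use a g in auto)
    then have "h z = \<tau> (z * \<alpha> a)" for z
      using \<phi>_homog[of a ?e "sg (snd ?e) z"] fun_cong[OF a, of "sg (snd ?e) z"]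
      by (simp del: snd_add)
    with \<open>a \<in> GA ?e\<close> show "\<exists>y\<in>GA ?e. \<forall>z. h z = \<tau> (z * y)"
      by (intro bexI[of _ "\<alpha> a"] \<alpha>_mem) auto
  qed
qed

text \<open>The image of 1 is linear for the inverse twists; conjugating it by the two automorphisms
  gives a trace map of the same kind as on the left. The right action carries no sign, so
  nondegeneracy is obtained for all \<open>a\<close> at once.\<close>

lemma right_iso_trace:
  assumes "bimodule_iso B UNIV AM HR"
  obtains \<tau> where "trace_map \<tau>"
    and "\<And>a. (\<And>z. \<tau> (a * z) = 0) \<Longrightarrow> a = 0"
    and "\<And>k h. hmap k h \<Longrightarrow> (\<And>b z. b \<in> B \<Longrightarrow> h (z * \<alpha> b) = h z * b) \<Longrightarrow>
      \<exists>x\<in>GA (k + S). \<forall>z. h z = \<tau> (x * z)"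
proof -
  obtain \<psi> where \<psi>: "left_hom B AM HR \<psi>" "right_hom UNIV AM HR \<psi>"
      "bij_betw \<psi> UNIV (internal_sum R)"
    using assms by (auto simp: bimodule_iso_def carrier_HR)
  have \<psi>_add: "additive_on UNIV \<psi>" and \<psi>_image: "\<psi> ` GA d \<subseteq> R d"
    and \<psi>_lact: "b \<in> B \<Longrightarrow> \<psi> (b * a) = lact HR b (\<psi> a)"
    and \<psi>_ract: "\<psi> (a * a') = ract HR (\<psi> a) a'" for d a a' b
    using \<psi>(1,2) by (simp_all add: left_hom_def right_hom_def graded_hom_def grade_HR)
  have \<psi>_mem: "\<psi> a \<in> R p" if "a \<in> GA p" for a p
    using \<psi>_image that by blast
  let ?\<rho> = "\<psi> 1"
  have \<psi>_eq: "\<psi> a z = ?\<rho> (\<alpha>' a * z)" for a z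
    using \<psi>_ract[of 1 a] by (simp add: ract_HR)
  have "?\<rho> \<in> R 0"
    by (rule \<psi>_mem[OF one_mem])
  then have \<rho>: "hmap (- S) ?\<rho>" and \<rho>_right: "\<And>b z. b \<in> B \<Longrightarrow> ?\<rho> (z * \<beta>' b) = ?\<rho> z * b"
    by (auto simp: R_iff)
  \<comment> \<open>Both sides are \<open>\<psi> b z\<close>: by right linearity at
    \<open>1 * b\<close>, and by left linearity at \<open>b * 1\<close>.\<close>
  have \<rho>_left: "?\<rho> (\<alpha>' b * z) = sg (snd S) b * ?\<rho> z" if "b \<in> B" for b z
    using \<psi>_lact[OF that, of 1] by (simp add: \<psi>_eq[symmetric] lact_HR[OF that])
  define \<tau> where "\<tau> z = \<beta>' (?\<rho> (\<alpha>' z))" for z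
  have \<beta>_\<tau>: "\<beta> (\<tau> z) = ?\<rho> (\<alpha>' z)" for z
    by (simp add: \<tau>_def hmap_B[OF \<rho>])
  have "hmap (- S) \<tau>"
    by (rule hmapI) (auto simp: \<tau>_def \<alpha>'_plus hmap_plus[OF \<rho>] \<beta>'_plus hmap_B[OF \<rho>]
        intro!: \<beta>'_mem hmap_mem[OF \<rho> \<alpha>'_mem])
  moreover have "\<tau> (\<beta> b * z) = sg (snd S) b * \<tau> z" if "b \<in> B" for b z
    using that by (simp add: \<tau>_def \<alpha>'_mult \<rho>_left \<beta>_B \<beta>'_mult sg_B hmap_B[OF \<rho>] \<beta>'_sg)
  moreover have "\<tau> (z * \<alpha> b) = \<tau> z * b" if "b \<in> B" for b z
    using that \<rho>_right[of "\<beta> b" "\<alpha>' z"] by (simp add: \<tau>_def \<alpha>'_mult \<beta>_B \<beta>'_mult hmap_B[OF \<rho>])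
  ultimately have trace: "trace_map \<tau>"
    by (simp add: trace_map_def)
  show thesis
  proof (rule that[OF trace])
    fix a assume zero: "\<And>z. \<tau> (a * z) = 0"
    have "\<psi> a z = 0" for z
      using \<beta>_\<tau>[of "a * \<alpha> z"] additive_on_zero[OF \<beta>_additive add_subgroup_zero[OF B.subgroup]]
      by (simp add: zero \<psi>_eq[of a] \<alpha>'_mult)
    then have "\<psi> a = \<psi> 0"
      using additive_on_zero[OF \<psi>_add] by (simp add: fun_eq_iff)
    then show "a = 0"
      using \<psi>(3) by (auto simp: bij_betw_def dest: injD)
  next
    fix k h assume h: "hmap k h" and h_right: "\<And>b z. b \<in> B \<Longrightarrow> h (z * \<alpha> b) = h z * b"
    let ?e = "k + S"
    \<comment> \<open>Conjugating back turns linearity for the twist by \<open>\<alpha>\<close> into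
      that of \<open>R ?e\<close>.\<close>
    let ?g = "\<lambda>z. \<beta> (h (\<alpha> z))"
    have "hmap (?e - S) ?g"
      by (rule hmapI) (auto simp: \<alpha>_plus \<beta>_plus hmap_plus[OF h] hmap_B[OF h]
          intro!: \<beta>_mem hmap_mem[OF h \<alpha>_mem])
    moreover have "?g (z * \<beta>' b) = ?g z * b" if "b \<in> B" for b z
      using that by (simp add: \<alpha>_mult h_right \<beta>'_B \<beta>_mult hmap_B[OF h])
    ultimately have g: "?g \<in> R ?e"
      by (simp add: R_iff)
    then obtain a where a: "\<psi> a = ?g"
      using \<psi>(3) R.grade_mem[OF g] by (metis bij_betw_imp_surj_on image_iff)
    have "a \<in> GA ?e"
      by (rule AR.graded_bij_reflects[OF \<psi>_add \<psi>_image bij_betw_imp_inj_on[OF \<psi>(3)]])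
        (use a g in auto)
    moreover have "h z = \<tau> (a * z)" for z
      using fun_cong[OF a, of "\<alpha>' z"] hmap_B[OF h, of z] inv_\<beta>[of "h z"]
      by (simp add: \<psi>_eq[of a] \<tau>_def \<alpha>'_mult)
    ultimately show "\<exists>x\<in>GA ?e. \<forall>z. h z = \<tau> (x * z)"
      by blast
  qed
qed

section \<open>The symmetric datum from a dual basis and a nondegenerate trace\<close>

lemma frobenius_system_of_left:
  assumes "left_dual_basis I s h x" "bimodule_iso UNIV B AM HL"
  shows "\<exists>\<tau> y. frobenius_system \<tau> I s x y"
proof -
  have fin: "finite I" and h: "\<And>i. i \<in> I \<Longrightarrow> hmap (- s i) (h i)"
    and lin: "\<And>i b a. i \<in> I \<Longrightarrow> b \<in> B \<Longrightarrow> h i (b * a) = b * h i a"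
    and x: "\<And>i. i \<in> I \<Longrightarrow> x i \<in> GA (s i)" and expand: "\<And>a. (\<Sum>i\<in>I. h i a * x i) = a"
    using assms(1) by (auto simp: left_dual_basis_def)
  obtain \<tau> where trace: "trace_map \<tau>"
    and nondeg: "\<And>p a. a \<in> GA p \<Longrightarrow> (\<And>z. \<tau> (z * a) = 0) \<Longrightarrow> a = 0"
    and repr: "\<And>k h. hmap k h \<Longrightarrow> (\<And>b z. b \<in> B \<Longrightarrow> h (\<beta> b * z) = sg (snd S) b * h z) \<Longrightarrow>
      \<exists>y\<in>GA (k + S). \<forall>z. h z = \<tau> (z * y)"
    using left_iso_trace[OF assms(2)] by metis
  have \<tau>: "hmap (- S) \<tau>" and \<tau>_left: "\<And>b z. b \<in> B \<Longrightarrow> \<tau> (\<beta> b * z) = sg (snd S) b * \<tau> z"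
    and \<tau>_right: "\<And>b z. b \<in> B \<Longrightarrow> \<tau> (z * \<alpha> b) = \<tau> z * b"
    using trace by (auto simp: trace_map_def)
  \<comment> \<open>The map is \<open>h i\<close> followed by the inverse of
    \<open>\<theta>\<close>, which turns strict left linearity into that of \<open>\<tau>\<close>;
    so an element \<open>y\<close> represents it.\<close>
  have "\<exists>y\<in>GA (- s i + S). \<forall>z. sg (snd S) (\<beta>' (h i z)) = \<tau> (z * y)" if i: "i \<in> I" for i
  proof (rule repr)
    show "hmap (- s i) (\<lambda>z. sg (snd S) (\<beta>' (h i z)))"
      by (rule hmapI) (auto simp: hmap_plus[OF h[OF i]] \<beta>'_plus hmap_B[OF h[OF i]] sg_plus
          intro!: sg_GB \<beta>'_mem hmap_mem[OF h[OF i]])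
    show "sg (snd S) (\<beta>' (h i (\<beta> b * z))) = sg (snd S) b * sg (snd S) (\<beta>' (h i z))"
      if "b \<in> B" for b z
      using that i by (simp add: lin \<beta>_B \<beta>'_mult hmap_B[OF h[OF i]] sg_mult)
  qed
  then obtain y where y: "\<And>i. i \<in> I \<Longrightarrow> y i \<in> GA (S - s i)"
    and hy: "\<And>i z. i \<in> I \<Longrightarrow> sg (snd S) (\<beta>' (h i z)) = \<tau> (z * y i)"
    by (simp add: add.commute[of "- _"]) metis
  have "\<theta> (\<tau> (a * y i)) = h i a" if "i \<in> I" for i a
    using that hmap_B[OF h[OF that]] by (simp add: \<theta>_def hy[symmetric])
  then have left: "(\<Sum>i\<in>I. \<theta> (\<tau> (a * y i)) * x i) = a" for a
    using expand[of a] by simp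
  \<comment> \<open>Nondegeneracy is at hand for homogeneous elements, so the expansion is proved in
    each degree; this is why \<open>?a\<close> must have the degree of \<open>a\<close>.\<close>
  have right: "(\<Sum>i\<in>I. y i * \<alpha> (\<tau> (x i * a))) = a" for a
  proof (rule A.additive_eqI[of "\<lambda>a. \<Sum>i\<in>I. y i * \<alpha> (\<tau> (x i * a))" "\<lambda>a. a"])
    fix p a assume a: "a \<in> GA p"
    let ?a = "\<Sum>i\<in>I. y i * \<alpha> (\<tau> (x i * a))"
    have mem: "?a \<in> GA p"
    proof (rule add_subgroup_sum[OF A.grade_subgroup])
      fix i assume i: "i \<in> I"
      have "\<alpha> (\<tau> (x i * a)) \<in> GA (s i + p + - S)"
        using hmap_mem[OF \<tau> mult_mem[OF x[OF i] a] refl] by (simp add: GB_iff \<alpha>_mem)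
      from mult_mem[OF y[OF i] this] show "y i * \<alpha> (\<tau> (x i * a)) \<in> GA p"
        by simp
    qed
    \<comment> \<open>Both \<open>?a\<close> and \<open>a\<close> pair with \<open>z\<close> to the
      sum of \<open>\<tau> (z * y i) * \<tau> (x i * a)\<close>: for \<open>?a\<close> the right
      factors come out of \<open>\<tau>\<close>; for \<open>a\<close> the left factors move into
      \<open>\<tau>\<close> and rebuild \<open>z\<close> by the first expansion.\<close>
    have "\<tau> (z * (?a - a)) = 0" for z
    proof -
      have "\<tau> (z * ?a) = (\<Sum>i\<in>I. \<tau> (z * y i) * \<tau> (x i * a))"
        by (simp add: sum_distrib_left hmap_sum[OF \<tau>] mult.assoc[symmetric] \<tau>_right hmap_B[OF \<tau>])
      also have "\<dots> = \<tau> ((\<Sum>i\<in>I. \<theta> (\<tau> (z * y i)) * x i) * a)"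
        by (simp add: sum_distrib_right hmap_sum[OF \<tau>] mult.assoc \<theta>_pull[OF \<tau>_left]
            hmap_B[OF \<tau>])
      finally show ?thesis
        using additive_on_diff[OF hmap_additive[OF \<tau>] add_subgroup_UNIV]
        by (simp add: left right_diff_distrib)
    qed
    then have "?a - a = 0"
      by (rule nondeg[OF add_subgroup_diff[OF A.grade_subgroup mem a]])
    then show "?a = a"
      by simp
  qed (simp_all add: additive_on_def distrib_left hmap_plus[OF \<tau>] \<alpha>_plus sum.distrib)
  have "frobenius_system \<tau> I s x y"
    by (simp add: frobenius_system_def trace fin x y left right)
  then show ?thesis
    by blast
qed

text \<open>The given basis supplies the \<open>y\<close> side, so the represented elements
  \<open>x i\<close> have the complementary degrees \<open>S - s i\<close>.\<close>

lemma frobenius_system_of_right: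
  assumes "right_dual_basis I s h y" "bimodule_iso B UNIV AM HR"
  shows "\<exists>\<tau> x. frobenius_system \<tau> I (\<lambda>i. S - s i) x (\<lambda>i. \<alpha> (y i))"
proof -
  have fin: "finite I" and h: "\<And>i. i \<in> I \<Longrightarrow> hmap (- s i) (h i)"
    and lin: "\<And>i b a. i \<in> I \<Longrightarrow> b \<in> B \<Longrightarrow> h i (a * b) = h i a * b"
    and y: "\<And>i. i \<in> I \<Longrightarrow> y i \<in> GA (s i)" and expand: "\<And>a. (\<Sum>i\<in>I. y i * h i a) = a"
    using assms(1) by (auto simp: right_dual_basis_def)
  obtain \<tau> where trace: "trace_map \<tau>"
    and nondeg: "\<And>a. (\<And>z. \<tau> (a * z) = 0) \<Longrightarrow> a = 0"
    and repr: "\<And>k h. hmap k h \<Longrightarrow> (\<And>b z. b \<in> B \<Longrightarrow> h (z * \<alpha> b) = h z * b) \<Longrightarrow>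
      \<exists>x\<in>GA (k + S). \<forall>z. h z = \<tau> (x * z)"
    using right_iso_trace[OF assms(2)] by metis
  have \<tau>: "hmap (- S) \<tau>" and \<tau>_left: "\<And>b z. b \<in> B \<Longrightarrow> \<tau> (\<beta> b * z) = sg (snd S) b * \<tau> z"
    and \<tau>_right: "\<And>b z. b \<in> B \<Longrightarrow> \<tau> (z * \<alpha> b) = \<tau> z * b"
    using trace by (auto simp: trace_map_def)
  \<comment> \<open>Precomposing \<open>h i\<close> with \<open>\<alpha>'\<close> turns strict right
    linearity into linearity for the twist by \<open>\<alpha>\<close>.\<close>
  have "\<exists>x\<in>GA (- s i + S). \<forall>z. h i (\<alpha>' z) = \<tau> (x * z)" if i: "i \<in> I" for i
  proof (rule repr)
    show "hmap (- s i) (\<lambda>z. h i (\<alpha>' z))"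
      by (rule hmapI) (auto simp: hmap_plus[OF h[OF i]] \<alpha>'_plus intro!: hmap_mem[OF h[OF i] \<alpha>'_mem])
  qed (simp add: \<alpha>'_mult lin i)
  then obtain x where x: "\<And>i. i \<in> I \<Longrightarrow> x i \<in> GA (S - s i)"
    and hx: "\<And>i z. i \<in> I \<Longrightarrow> h i (\<alpha>' z) = \<tau> (x i * z)"
    by (simp add: add.commute[of "- _"]) metis
  have right: "(\<Sum>i\<in>I. \<alpha> (y i) * \<alpha> (\<tau> (x i * a))) = a" for a
    using arg_cong[OF expand[of "\<alpha>' a"], of \<alpha>] by (simp add: \<alpha>_sum \<alpha>_mult hx)
  \<comment> \<open>The same comparison of pairings, with the roles of the two expansions
    exchanged.\<close>
  have left: "(\<Sum>i\<in>I. \<theta> (\<tau> (a * \<alpha> (y i))) * x i) = a" for a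
  proof -
    let ?a = "\<Sum>i\<in>I. \<theta> (\<tau> (a * \<alpha> (y i))) * x i"
    have "\<tau> ((?a - a) * z) = 0" for z
    proof -
      have "\<tau> (?a * z) = (\<Sum>i\<in>I. \<tau> (a * \<alpha> (y i)) * \<tau> (x i * z))"
        by (simp add: sum_distrib_right hmap_sum[OF \<tau>] mult.assoc \<theta>_pull[OF \<tau>_left]
            hmap_B[OF \<tau>])
      also have "\<dots> = \<tau> (a * (\<Sum>i\<in>I. \<alpha> (y i) * \<alpha> (\<tau> (x i * z))))"
        by (simp add: sum_distrib_left hmap_sum[OF \<tau>] mult.assoc[symmetric] \<tau>_right hmap_B[OF \<tau>])
      finally show ?thesis
        using additive_on_diff[OF hmap_additive[OF \<tau>] add_subgroup_UNIV]
        by (simp add: right left_diff_distrib)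
    qed
    then have "?a - a = 0"
      by (rule nondeg)
    then show ?thesis
      by simp
  qed
  have "frobenius_system \<tau> I (\<lambda>i. S - s i) x (\<lambda>i. \<alpha> (y i))"
    by (simp add: frobenius_system_def trace fin x y \<alpha>_mem left right)
  then show ?thesis
    by blast
qed

section \<open>The equivalence of the two sets of conditions\<close>

theorem left_iff_right:
  "fin_gen_left B AM \<and> projective_left B GB AM \<and> bimodule_iso UNIV B AM HL
    \<longleftrightarrow> fin_gen_right B AM \<and> projective_right B GB AM \<and> bimodule_iso B UNIV AM HR"
proof
  assume left: "fin_gen_left B AM \<and> projective_left B GB AM \<and> bimodule_iso UNIV B AM HL"
  then obtain I :: "'a set" and s h x where "left_dual_basis I s h x"
    using left_dual_basis_exists by blast
  then obtain \<tau> y where "frobenius_system \<tau> I s x y"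
    using frobenius_system_of_left left by blast
  then show "fin_gen_right B AM \<and> projective_right B GB AM \<and> bimodule_iso B UNIV AM HR"
    using right_dual_basisD[OF right_dual_basis_frob] right_iso_frob by blast
next
  assume right: "fin_gen_right B AM \<and> projective_right B GB AM \<and> bimodule_iso B UNIV AM HR"
  then obtain I :: "'a set" and s h y where "right_dual_basis I s h y"
    using right_dual_basis_exists by blast
  then obtain \<tau> x where "frobenius_system \<tau> I (\<lambda>i. S - s i) x (\<lambda>i. \<alpha> (y i))"
    using frobenius_system_of_right right by blast
  then show "fin_gen_left B AM \<and> projective_left B GB AM \<and> bimodule_iso UNIV B AM HL"
    using left_dual_basisD[OF left_dual_basis_frob] left_iso_frob by blast
qed

end

theorem proposition3p1:
  fixes GA :: "'l::ab_group_add \<times> bit \<Rightarrow> 'a::{ring,monoid_mult} set"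
    and B :: "'a set"
    and \<alpha> \<beta> :: "'a \<Rightarrow> 'a"
    and lam :: 'l and \<pi> :: bit
  defines "GB \<equiv> sub_grading GA B"
  assumes "graded_superring UNIV GA"
    and "graded_subring GA B"
    and "graded_automorphism UNIV GA \<alpha>"
    and "graded_automorphism B GB \<beta>"
  shows
    "(fin_gen_left B (mult_bimodule UNIV GA) \<and> projective_left B GB (mult_bimodule UNIV GA)
      \<and> bimodule_iso UNIV B (mult_bimodule UNIV GA)
          (HOM_left GA GB (twisted_bimodule UNIV GA \<beta> \<alpha>)
            (shift GB (lam, \<pi>) (mult_bimodule B GB))))
     \<longleftrightarrow>
     (fin_gen_right B (mult_bimodule UNIV GA) \<and> projective_right B GB (mult_bimodule UNIV GA)
      \<and> bimodule_iso B UNIV (mult_bimodule UNIV GA)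
          (HOM_right B (twisted_bimodule UNIV GA (inv \<alpha>) (inv_into B \<beta>))
            (shift GB (lam, \<pi>) (mult_bimodule B GB))))"
proof -
  interpret twisted_extension GA B \<alpha> \<beta> "(lam, \<pi>)"
    by standard (use assms in auto)
  show ?thesis
    using left_iff_right unfolding GB_def \<alpha>'_def \<beta>'_def .
qed

end
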